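(* Let $\{\widehat\theta_N\}_{N=1}^\infty\subseteq S$ be a sequence of hyper-parameter estimates, for some compact set $S\subseteq R_\theta$. Assume: (a) $U\subseteq\mathbb R^{d_u}$ is bounded; (b) $\sup_{u\in U}\|\mathcal G(u)-m_N^{\mathcal G}(\widehat\theta_N;u)\|$ and $\sup_{u\in U}|\Phi(u)-m_N^\Phi(\widehat\theta_N;u)|$ can be bounded uniformly in $N$, and $\sup_{u\in U}k_N(\widehat\theta_N;u,u)$ converges to $0$ as $N$ tends to infinity; (c) $\sup_{u\in U}\|\mathcal G(u)\|\le C_{\mathcal G}<\infty$; (d) $\mathbb E\big(\sup_{u\in U}(\Phi_N(\widehat\theta_N;u)-m_N^\Phi(\widehat\theta_N;u))\big)$ and $\mathbb E\big(\sup_{u\in U}(\mathcal G_N^j(\widehat\theta_N;u)-m_N^{\mathcal G^j}(\widehat\theta_N;u))\big)$, for $1\le j\le d_y$, can be bounded uniformly in $N$. Then there exist constants $C_1,C_2,C_3$ and $C_4$, independent of $N$, such that for any $\delta>0$, $$d_{\mathrm{Hell}}\big(\mu^y,\mu^{y,N,\mathcal G,\widehat\theta_N}_{\mathrm{marginal}}\big)\le C_1\Big\|\Big(\mathbb E_{\nu_N^{\mathcal G,\widehat\theta_N}}\big(\|\mathcal G-\mathcal G_N(\widehat\theta_N)\|^{1+\delta}\big)\Big)^{1/(1+\delta)}\Big\|_{L^2_{\mu_0}(U)},$$ $$d_{\mathrm{Hell}}\big(\mu^y,\mu^{y,N,\Phi,\widehat\theta_N}_{\mathrm{marginal}}\big)\le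 C_2\Big\|\Big(\mathbb E_{\nu_N^{\Phi,\widehat\theta_N}}\big(|\Phi-\Phi_N(\widehat\theta_N)|^{1+\delta}\big)\Big)^{1/(1+\delta)}\Big\|_{L^2_{\mu_0}(U)},$$ and $$\Big(\mathbb E_{\nu_N^{\mathcal G,\widehat\theta_N}}\big(d_{\mathrm{Hell}}(\mu^y,\mu^{y,N,\mathcal G,\widehat\theta_N}_{\mathrm{sample}})^2\big)\Big)^{1/2}\le C_3\Big\|\Big(\mathbb E_{\nu_N^{\mathcal G,\widehat\theta_N}}\big(\|\mathcal G-\mathcal G_N(\widehat\theta_N)\|^{2+\delta}\big)\Big)^{1/(2+\delta)}\Big\|_{L^2_{\mu_0}(U)},$$ $$\Big(\mathbb E_{\nu_N^{\Phi,\widehat\theta_N}}\big(d_{\mathrm{Hell}}(\mu^y,\mu^{y,N,\Phi,\widehat\theta_N}_{\mathrm{sample}})^2\big)\Big)^{1/2}\le C_4\Big\|\Big(\mathbb E_{\nu_N^{\Phi,\widehat\theta_N}}\big(|\Phi-\Phi_N(\widehat\theta_N)|^{2+\delta}\big)\Big)^{1/(2+\delta)}\Big\|_{L^2_{\mu_0}(U)}.$$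
   Context: Bayesian inverse problem: data $y\in\mathbb R^{d_y}$ is given by $y=\mathcal G(u)+\eta$ with forward map $\mathcal G:U\to\mathbb R^{d_y}$ and Gaussian noise $\eta\sim\mathcal N(0,\Gamma)$, $\Gamma$ a known positive-definite covariance matrix. $\mu_0$ is a prior probability measure with $\mu_0(U)=1$. With $\|x\|_\Gamma^2=x^T\Gamma^{-1}x$ and $\Phi(u)=\frac12\|y-\mathcal G(u)\|_\Gamma^2$, the posterior $\mu^y$ is $$\frac{d\mu^y}{d\mu_0}(u)=\frac1Z\exp(-\Phi(u)),\qquad Z=\mathbb E_{\mu_0}(\exp(-\Phi)).$$ Gaussian process emulators: for a scalar function $g:U\to\mathbb R$, prior mean $m(\theta;\cdot)$ and positive-definite covariance kernel $k(\theta;\cdot,\cdot)$ on $U$ depending on hyper-parameters $\theta\in R_\theta\subseteq\mathbb R^{d_\theta}$, and distinct design points $D_N=\{u^1,\dots,u^N\}\subseteq U$, the predictive mean and covariance are $$m_N^g(\theta;u)=m(\theta;u)+k(\theta;u,D_N)^TK(\theta;D_N)^{-1}\big(g(D_N)-m(\theta;D_N)\big),$$ $$k_N(\theta;u,u')=k(\theta;u,u')-k(\theta;u,D_N)^TK(\theta;D_N)^{-1}k(\theta;u',D_N),$$ where $g(D_N)=[g(u^n)]_n$, $m(\theta;D_N)=[m(\theta;u^n)]_{n}$, $k(\theta;u,D_N)=[k(\theta;u,u^n)]_n$, $K(\theta;D_N)_{ij}=k(\theta;u^i,u^j)$. $\Phi_N(\theta)$ is the Gaussian process with mean $m_N^\Phi(\theta)$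 and covariance $k_N(\theta)$, with law $\nu_N^{\Phi,\theta}$. $\mathcal G_N(\theta)=(\mathcal G_N^1(\theta),\dots,\mathcal G_N^{d_y}(\theta))$ consists of $d_y$ independent Gaussian processes, $\mathcal G_N^j(\theta)$ having mean $m_N^{\mathcal G^j}(\theta)$ and covariance $k_N(\theta)$; its law is $\nu_N^{\mathcal G,\theta}$, and $m_N^{\mathcal G}=[m_N^{\mathcal G^1},\dots,m_N^{\mathcal G^{d_y}}]$. As usual, $\mathcal G$, $m(\theta)$, $k(\theta)$ are measurable in $u$, and measurable, separable versions of the processes are used so that the suprema and integrals make sense. Random (sample) approximations: $$\frac{d\mu^{y,N,\mathcal G,\theta}_{\mathrm{sample}}}{d\mu_0}(u)=\frac{\exp(-\frac12\|y-\mathcal G_N(\theta;u)\|_\Gamma^2)}{Z^{N,\mathcal G,\theta}_{\mathrm{sample}}},\quad Z^{N,\mathcal G,\theta}_{\mathrm{sample}}=\mathbb E_{\mu_0}\big(\exp(-\tfrac12\|y-\mathcal G_N(\theta)\|_\Gamma^2)\big),$$ $$\frac{d\mu^{y,N,\Phi,\theta}_{\mathrm{sample}}}{d\mu_0}(u)=\frac{\exp(-\Phi_N(\theta;u))}{Z^{N,\Phi,\theta}_{\mathrm{sample}}},\quad Z^{N,\Phi,\theta}_{\mathrm{sample}}=\mathbb E_{\mu_0}\big(\exp(-\Phi_N(\theta))\big).$$ Marginal approximations: $$\frac{d\mu^{y,N,\mathcal G,\theta}_{\mathrm{marginal}}}{d\mu_0}(u)=\frac{\mathbb E_{\nu_N^{\mathcal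 G,\theta}}\big(\exp(-\frac12\|y-\mathcal G_N(\theta;u)\|_\Gamma^2)\big)}{\mathbb E_{\nu_N^{\mathcal G,\theta}}(Z^{N,\mathcal G,\theta}_{\mathrm{sample}})},\qquad \frac{d\mu^{y,N,\Phi,\theta}_{\mathrm{marginal}}}{d\mu_0}(u)=\frac{\mathbb E_{\nu_N^{\Phi,\theta}}\big(\exp(-\Phi_N(\theta;u))\big)}{\mathbb E_{\nu_N^{\Phi,\theta}}(Z^{N,\Phi,\theta}_{\mathrm{sample}})}.$$ $d_{\mathrm{Hell}}$ is the Hellinger distance: $d_{\mathrm{Hell}}(\mu,\mu')^2=\frac12\int_U\big(\sqrt{d\mu/d\mu_0}-\sqrt{d\mu'/d\mu_0}\big)^2d\mu_0$. In the bounds, expectations over $\nu_N$ are taken pointwise in $u$, and then the $L^2_{\mu_0}(U)$ norm in $u$; for the random process, $\widehat\theta_N$ is a fixed value. *)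

theory Defs
  imports "HOL-Probability.Probability" "Jordan_Normal_Form.Gauss_Jordan_Elimination"
begin

text \<open>Both \<open>HOL-Analysis\<close> and \<open>Jordan_Normal_Form\<close> declare \<open>$\<close> and
  \<open>\<bullet>\<close>; below \<open>$\<close> is only used for the vectors of \<open>HOL-Analysis\<close>. Matrices whose size is
  the number of design points are those of \<open>Jordan_Normal_Form\<close>.\<close>

no_notation vec_index (infixl \<open>$\<close> 100)


section \<open>Posteriors and the Hellinger distance\<close>

definition pos_def_matrix :: "real ^ 'n ^ 'n \<Rightarrow> bool" where
  "pos_def_matrix A \<longleftrightarrow>
     Finite_Cartesian_Product.transpose A = A \<and> (\<forall>x. x \<noteq> 0 \<longrightarrow> inner x (A *v x) > 0)"

definition weighted_sqnorm :: "real ^ 'n ^ 'n \<Rightarrow> real ^ 'n \<Rightarrow> real" where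
  "weighted_sqnorm \<Gamma> x = inner x (matrix_inv \<Gamma> *v x)"

definition misfit :: "real ^ 'n ^ 'n \<Rightarrow> real ^ 'n \<Rightarrow> ('u \<Rightarrow> real ^ 'n) \<Rightarrow> 'u \<Rightarrow> real" where
  "misfit \<Gamma> y G u = 1 / 2 * weighted_sqnorm \<Gamma> (y - G u)"

text \<open>The measure with density proportional to \<open>exp (- \<Psi>)\<close>. With the exact potential this is the
  posterior; with one realisation of a random potential it is the sample approximation.\<close>

definition posterior :: "'u measure \<Rightarrow> ('u \<Rightarrow> real) \<Rightarrow> 'u measure" where
  "posterior \<mu>\<^sub>0 \<Psi> = density \<mu>\<^sub>0 (\<lambda>u. ennreal (exp (- \<Psi> u) / (\<integral>v. exp (- \<Psi> v) \<partial>\<mu>\<^sub>0)))"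

definition marginal_posterior ::
    "'w measure \<Rightarrow> 'u measure \<Rightarrow> ('w \<Rightarrow> 'u \<Rightarrow> real) \<Rightarrow> 'u measure" where
  "marginal_posterior P \<mu>\<^sub>0 \<Psi> = density \<mu>\<^sub>0 (\<lambda>u. ennreal
     ((\<integral>\<omega>. exp (- \<Psi> \<omega> u) \<partial>P) / (\<integral>\<omega>. (\<integral>v. exp (- \<Psi> \<omega> v) \<partial>\<mu>\<^sub>0) \<partial>P)))"

definition hellinger :: "'u measure \<Rightarrow> 'u measure \<Rightarrow> 'u measure \<Rightarrow> real" where
  "hellinger \<mu>\<^sub>0 \<mu> \<mu>' = sqrt (1 / 2 *
     (\<integral>u. (sqrt (enn2real (RN_deriv \<mu>\<^sub>0 \<mu> u)) - sqrt (enn2real (RN_deriv \<mu>\<^sub>0 \<mu>' u)))\<^sup>2 \<partial>\<mu>\<^sub>0))"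

definition L2_norm :: "'u measure \<Rightarrow> ('u \<Rightarrow> real) \<Rightarrow> real" where
  "L2_norm M f = sqrt (\<integral>u. (f u)\<^sup>2 \<partial>M)"


section \<open>Gaussian process regression\<close>

text \<open>Strict positive definiteness, so that the covariance matrix of distinct points is
  invertible.\<close>

definition pos_def_kernel :: "'u set \<Rightarrow> ('u \<Rightarrow> 'u \<Rightarrow> real) \<Rightarrow> bool" where
  "pos_def_kernel U k \<longleftrightarrow>
     (\<forall>u\<in>U. \<forall>v\<in>U. k u v = k v u) \<and>
     (\<forall>F c. finite F \<and> F \<subseteq> U \<and> (\<exists>u\<in>F. c u \<noteq> 0) \<longrightarrow>
        (\<Sum>u\<in>F. \<Sum>v\<in>F. c u * c v * k u v) > 0)"

definition cross_cov :: "('u \<Rightarrow> 'u \<Rightarrow> real) \<Rightarrow> 'u list \<Rightarrow> 'u \<Rightarrow> real Matrix.vec" where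
  "cross_cov k D u = vec_of_list (map (k u) D)"

definition cov_matrix :: "('u \<Rightarrow> 'u \<Rightarrow> real) \<Rightarrow> 'u list \<Rightarrow> real Matrix.mat" where
  "cov_matrix k D = Matrix.mat (length D) (length D) (\<lambda>(i, j). k (D ! i) (D ! j))"

definition cov_matrix_inv :: "('u \<Rightarrow> 'u \<Rightarrow> real) \<Rightarrow> 'u list \<Rightarrow> real Matrix.mat" where
  "cov_matrix_inv k D = the (mat_inverse (cov_matrix k D))"

definition pred_mean ::
    "('u \<Rightarrow> real) \<Rightarrow> ('u \<Rightarrow> 'u \<Rightarrow> real) \<Rightarrow> 'u list \<Rightarrow> ('u \<Rightarrow> real) \<Rightarrow> 'u \<Rightarrow> real" where
  "pred_mean m k D g u = m u + scalar_prod (cross_cov k D u)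
     (cov_matrix_inv k D *\<^sub>v (vec_of_list (map g D) - vec_of_list (map m D)))"

definition pred_cov :: "('u \<Rightarrow> 'u \<Rightarrow> real) \<Rightarrow> 'u list \<Rightarrow> 'u \<Rightarrow> 'u \<Rightarrow> real" where
  "pred_cov k D u u' =
     k u u' - scalar_prod (cross_cov k D u) (cov_matrix_inv k D *\<^sub>v cross_cov k D u')"

definition pred_mean_vec ::
    "('u \<Rightarrow> real) \<Rightarrow> ('u \<Rightarrow> 'u \<Rightarrow> real) \<Rightarrow> 'u list \<Rightarrow> ('u \<Rightarrow> real ^ 'n) \<Rightarrow> 'u \<Rightarrow> real ^ 'n" where
  "pred_mean_vec m k D G u = (\<chi> j. pred_mean m k D (\<lambda>v. G v $ j) u)"


section \<open>Random processes\<close>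

text \<open>Normal law with mean \<open>a\<close> and variance \<open>v\<close>, where \<open>v = 0\<close> is allowed: the predictive
  variance vanishes at the design points.\<close>

definition normal_rv :: "'w measure \<Rightarrow> ('w \<Rightarrow> real) \<Rightarrow> real \<Rightarrow> real \<Rightarrow> bool" where
  "normal_rv P X a v \<longleftrightarrow> X \<in> borel_measurable P \<and> v \<ge> 0 \<and>
     (if v = 0 then AE \<omega> in P. X \<omega> = a
      else distributed P lborel X (\<lambda>x. ennreal (normal_density a (sqrt v) x)))"

text \<open>The finite-dimensional distributions are multivariate normal, possibly degenerate: a random
  vector is Gaussian if all linear combinations of its entries are normal.\<close>

definition gaussian_process ::
    "'w measure \<Rightarrow> 'u set \<Rightarrow> ('w \<Rightarrow> 'u \<Rightarrow> real) \<Rightarrow> ('u \<Rightarrow> real) \<Rightarrow> ('u \<Rightarrow> 'u \<Rightarrow> real) \<Rightarrow> bool" where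
  "gaussian_process P U X m k \<longleftrightarrow> prob_space P \<and>
     (\<forall>F c. finite F \<and> F \<subseteq> U \<longrightarrow>
        normal_rv P (\<lambda>\<omega>. \<Sum>u\<in>F. c u * X \<omega> u)
          (\<Sum>u\<in>F. c u * m u) (\<Sum>u\<in>F. \<Sum>v\<in>F. c u * c v * k u v))"

definition indep_components ::
    "'w measure \<Rightarrow> 'u set \<Rightarrow> ('w \<Rightarrow> 'u \<Rightarrow> real ^ 'n) \<Rightarrow> bool" where
  "indep_components P U X \<longleftrightarrow>
     prob_space.indep_vars P (\<lambda>_. Pi\<^sub>M U (\<lambda>_. borel)) (\<lambda>j \<omega>. \<lambda>u\<in>U. X \<omega> u $ j) UNIV"

definition measurable_process ::
    "'w measure \<Rightarrow> 'u measure \<Rightarrow> ('w \<Rightarrow> 'u \<Rightarrow> 'b :: topological_space) \<Rightarrow> bool" where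
  "measurable_process P M X \<longleftrightarrow> (\<lambda>(\<omega>, u). X \<omega> u) \<in> borel_measurable (P \<Otimes>\<^sub>M M)"

text \<open>Separability in the sense of Doob: almost surely, the whole path lies in the closure of its
  restriction to a fixed countable set.\<close>

definition separable_process ::
    "'w measure \<Rightarrow> 'u :: topological_space set \<Rightarrow> ('w \<Rightarrow> 'u \<Rightarrow> 'b :: topological_space) \<Rightarrow> bool" where
  "separable_process P U X \<longleftrightarrow>
     (\<exists>Q. countable Q \<and> Q \<subseteq> U \<and>
        (AE \<omega> in P. \<forall>u\<in>U. (u, X \<omega> u) \<in> closure ((\<lambda>v. (v, X \<omega> v)) ` Q)))"

text \<open>The supremum has an expectation and it is at most \<open>B\<close>. The integral is taken over the
  completion because the supremum of a separable process is measurable only up to null sets.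
  Boundedness and integrability are required explicitly because \<open>SUP\<close> and the Bochner integral
  have default values otherwise.\<close>

definition expected_sup_le :: "'w measure \<Rightarrow> 'u set \<Rightarrow> ('w \<Rightarrow> 'u \<Rightarrow> real) \<Rightarrow> real \<Rightarrow> bool" where
  "expected_sup_le P U X B \<longleftrightarrow>
     (AE \<omega> in P. bdd_above (X \<omega> ` U)) \<and>
     integrable (completion P) (\<lambda>\<omega>. SUP u\<in>U. X \<omega> u) \<and>
     (\<integral>\<omega>. (SUP u\<in>U. X \<omega> u) \<partial>completion P) \<le> B"

end

theory Submission
  imports Defs
begin

text \<open>For two probability densities \<open>f / Z\<close> and \<open>g / W\<close>, expanding the square gives
  \<open>d\<^sub>H\<^sub>e\<^sub>l\<^sub>l\<^sup>2 \<le> (1 / Z) \<integral> (sqrt f - sqrt g)\<^sup>2\<close> without any control of \<open>W\<close>. With \<open>f = exp (- \<Phi>)\<close> bounded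
  below, everything reduces to estimates for fixed \<open>u\<close>: the error of \<open>exp (- \<Psi>)\<close> in mean, and of
  \<open>exp (- \<Psi> / 2)\<close> in mean square, must be at most a constant times the first, respectively second,
  moment of the emulator error. For the emulated forward map this holds because
  \<open>x \<mapsto> exp (- \<parallel>y - x\<parallel>\<^sup>2 / 2)\<close> is Lipschitz. For the emulated potential \<open>exp (- \<Phi>\<^sub>N)\<close> is unbounded, but
  weighting a normal law by it only shifts the mean by the variance \<open>v\<close>, and \<open>v\<close> is itself bounded by
  the moments of the error. Lyapunov's inequality then raises the exponents from \<open>1\<close> and \<open>2\<close> to
  \<open>1 + \<delta>\<close> and \<open>2 + \<delta>\<close>, with constants independent of \<open>\<delta>\<close>.\<close>

section \<open>The Hellinger distance of normalised densities\<close>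

text \<open>Only the evidence of \<open>f\<close> appears on the right-hand side, so no lower bound on a random
  evidence is ever needed.\<close>

lemma (in sigma_finite_measure) hellinger_density_sq_le:
  fixes f g :: "'a \<Rightarrow> real"
  assumes f: "integrable M f" and g: "integrable M g"
    and f0: "\<And>u. 0 \<le> f u" and g0: "\<And>u. 0 \<le> g u"
    and Z: "0 < (\<integral>u. f u \<partial>M)" and W: "0 < (\<integral>u. g u \<partial>M)"
  shows "(hellinger M (density M (\<lambda>u. ennreal (f u / (\<integral>v. f v \<partial>M))))
            (density M (\<lambda>u. ennreal (g u / (\<integral>v. g v \<partial>M)))))\<^sup>2
          \<le> (\<integral>u. (sqrt (f u) - sqrt (g u))\<^sup>2 \<partial>M) / (\<integral>u. f u \<partial>M)"
proof -
  define Z W where "Z = (\<integral>u. f u \<partial>M)" and "W = (\<integral>u. g u \<partial>M)"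
  define I where "I = (\<integral>u. sqrt (f u) * sqrt (g u) \<partial>M)"
  have [measurable]: "f \<in> borel_measurable M" "g \<in> borel_measurable M" using f g by auto
  have pos: "0 < Z" "0 < W" using Z W by (auto simp: Z_def W_def)
  have [simp]: "(sqrt (f u))\<^sup>2 = f u" "(sqrt (g u))\<^sup>2 = g u" for u using f0 g0 by auto
  have fg: "integrable M (\<lambda>u. sqrt (f u) * sqrt (g u))"
  proof (rule Bochner_Integration.integrable_bound)
    show "integrable M (\<lambda>u. f u + g u)" using f g by auto
    show "AE u in M. norm (sqrt (f u) * sqrt (g u)) \<le> norm (f u + g u)"
    proof (rule AE_I2)
      fix u
      have "0 \<le> (sqrt (f u) - sqrt (g u))\<^sup>2" by simp
      also have "\<dots> = f u + g u - 2 * (sqrt (f u) * sqrt (g u))" by (simp add: power2_diff)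
      finally show "norm (sqrt (f u) * sqrt (g u)) \<le> norm (f u + g u)"
        using f0[of u] g0[of u] by (simp add: abs_mult)
    qed
  qed simp
  have I0: "0 \<le> I" unfolding I_def using f0 g0 by (intro Bochner_Integration.integral_nonneg) auto
  \<comment> \<open>Both uses are covered by general coefficients: \<open>1 / sqrt Z\<close> and
    \<open>1 / sqrt W\<close> give the Hellinger integral, \<open>1\<close> and \<open>1\<close> the
    unnormalised one.\<close>
  have sq_int: "(\<integral>u. (\<alpha> * sqrt (f u) - \<beta> * sqrt (g u))\<^sup>2 \<partial>M) = \<alpha>\<^sup>2 * Z + \<beta>\<^sup>2 * W - 2 * \<alpha> * \<beta> * I" for \<alpha> \<beta>
  proof -
    have "(\<alpha> * sqrt (f u) - \<beta> * sqrt (g u))\<^sup>2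
        = \<alpha>\<^sup>2 * f u + \<beta>\<^sup>2 * g u - 2 * \<alpha> * \<beta> * (sqrt (f u) * sqrt (g u))" for u
      by (simp add: power2_diff power_mult_distrib)
    then show ?thesis
      using f g fg by (simp add: Z_def W_def I_def)
  qed
  let ?\<mu> = "density M (\<lambda>u. ennreal (f u / Z))" and ?\<nu> = "density M (\<lambda>u. ennreal (g u / W))"
  \<comment> \<open>\<open>hellinger\<close> refers to \<open>RN_deriv\<close>, which is determined
    only almost everywhere; uniqueness identifies it with the given densities under the
    integral.\<close>
  have "AE u in M. ennreal (f u / Z) = RN_deriv M ?\<mu> u" by (rule RN_deriv_unique) auto
  moreover have "AE u in M. ennreal (g u / W) = RN_deriv M ?\<nu> u" by (rule RN_deriv_unique) auto
  ultimately have "AE u in M. (sqrt (enn2real (RN_deriv M ?\<mu> u)) - sqrt (enn2real (RN_deriv M ?\<nu> u)))\<^sup>2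
      = ((1 / sqrt Z) * sqrt (f u) - (1 / sqrt W) * sqrt (g u))\<^sup>2"
  proof eventually_elim
    case (elim u)
    show ?case
      unfolding elim[symmetric] using pos f0[of u] g0[of u] by (simp add: real_sqrt_divide)
  qed
  then have "(\<integral>u. (sqrt (enn2real (RN_deriv M ?\<mu> u)) - sqrt (enn2real (RN_deriv M ?\<nu> u)))\<^sup>2 \<partial>M)
      = (\<integral>u. ((1 / sqrt Z) * sqrt (f u) - (1 / sqrt W) * sqrt (g u))\<^sup>2 \<partial>M)"
    by (intro integral_cong_AE) auto
  also have "\<dots> = 2 - 2 * (I / (sqrt Z * sqrt W))"
    unfolding sq_int using pos by (simp add: power_divide)
  finally have eq: "(\<integral>u. (sqrt (enn2real (RN_deriv M ?\<mu> u)) - sqrt (enn2real (RN_deriv M ?\<nu> u)))\<^sup>2 \<partial>M)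
      = 2 - 2 * (I / (sqrt Z * sqrt W))" .
  \<comment> \<open>\<open>t\<close> is the Hellinger affinity. Nonnegativity of the integral of the
    square yields \<open>t \<le> 1\<close>, which is the Cauchy-Schwarz inequality for
    \<open>sqrt f\<close> and \<open>sqrt g\<close>.\<close>
  define t where "t = I / (sqrt Z * sqrt W)"
  have t: "I = t * sqrt Z * sqrt W" using pos by (simp add: t_def)
  have "0 \<le> (\<integral>u. (sqrt (enn2real (RN_deriv M ?\<mu> u)) - sqrt (enn2real (RN_deriv M ?\<nu> u)))\<^sup>2 \<partial>M)"
    by (intro Bochner_Integration.integral_nonneg) auto
  then have t01: "t \<le> 1" "0 \<le> t"
    using I0 pos unfolding eq t_def[symmetric] by (simp, simp add: t_def)
  have "(hellinger M ?\<mu> ?\<nu>)\<^sup>2 = 1 - t"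
    unfolding hellinger_def eq t_def[symmetric] using t01 by simp
  moreover have "Z * (1 - t) \<le> Z + W - 2 * I"
  proof -
    \<comment> \<open>Completing the square in \<open>sqrt W\<close> leaves at least
      \<open>Z * (1 - t\<^sup>2)\<close>, whatever \<open>W\<close> is.\<close>
    have "Z + W - 2 * I = Z * (1 - t\<^sup>2) + (sqrt W - t * sqrt Z)\<^sup>2"
      unfolding t using pos by (simp add: power2_diff power_mult_distrib algebra_simps)
    moreover have "Z * (1 - t) \<le> Z * (1 - t\<^sup>2)"
      using pos t01 by (intro mult_left_mono) (auto simp: power2_eq_square intro: mult_left_le)
    ultimately show ?thesis 
      using zero_le_power2[of "sqrt W - t * sqrt Z"] by linarith
  qed
  moreover have "(\<integral>u. (sqrt (f u) - sqrt (g u))\<^sup>2 \<partial>M) = Z + W - 2 * I"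
    using sq_int[of 1 1] by simp
  ultimately show ?thesis
    using pos(1) by (fold Z_def W_def) (simp only: pos_le_divide_eq mult.commute[of _ Z])
qed

section \<open>Normal random variables\<close>

text \<open>Completing the square: the law \<open>N(a, v)\<close> reweighted by \<open>exp (- x)\<close> is a multiple of
  \<open>N(a - v, v)\<close>.\<close>

lemma normal_rv_tilt:
  assumes "normal_rv P X a v" and [measurable]: "h \<in> borel_measurable borel"
    and int: "integrable P (\<lambda>\<omega>. h (X \<omega> - v))"
  shows "has_bochner_integral P (\<lambda>\<omega>. exp (- X \<omega>) * h (X \<omega>))
           (exp (- a + v / 2) * (\<integral>\<omega>. h (X \<omega> - v) \<partial>P) :: real)"
proof (cases "v = 0")
  \<comment> \<open>With zero variance there is no density, but no shift either:
    \<open>X = a\<close> almost surely and \<open>h (X - v) = h X\<close>.\<close>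
  case True
  then have [measurable]: "X \<in> borel_measurable P" and AE: "AE \<omega> in P. X \<omega> = a"
    using assms by (auto simp: normal_rv_def)
  have "has_bochner_integral P (\<lambda>\<omega>. exp (- a) * h (X \<omega>)) (exp (- a) * (\<integral>\<omega>. h (X \<omega>) \<partial>P))"
    using int True by (intro has_bochner_integral_mult_right has_bochner_integral_integrable) auto
  then show ?thesis
    using True AE by (subst has_bochner_integral_cong_AE[where g="\<lambda>\<omega>. exp (- a) * h (X \<omega>)"]) auto
next
  case False
  define \<sigma> where "\<sigma> = sqrt v"
  have v: "v > 0" "v = \<sigma>\<^sup>2" "\<sigma> > 0" using False assms by (auto simp: normal_rv_def \<sigma>_def)
  have D: "distributed P lborel X (\<lambda>x. ennreal (normal_density a \<sigma> x))"
    using False assms by (auto simp: normal_rv_def \<sigma>_def)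
  have tilt: "normal_density a \<sigma> x * exp (- x) = exp (- a + v / 2) * normal_density (a - v) \<sigma> x" for x
  proof -
    have "- (x - a)\<^sup>2 / (2 * \<sigma>\<^sup>2) + - x = (- a + v / 2) + - (x - (a - v))\<^sup>2 / (2 * \<sigma>\<^sup>2)"
      using v(3) unfolding v(2) by (simp add: field_simps power2_eq_square)
    then have "exp (- (x - a)\<^sup>2 / (2 * \<sigma>\<^sup>2)) * exp (- x)
        = exp (- a + v / 2) * exp (- (x - (a - v))\<^sup>2 / (2 * \<sigma>\<^sup>2))"
      by (simp only: exp_add[symmetric])
    then show ?thesis unfolding normal_density_def by simp
  qed
  \<comment> \<open>The form \<open>- v + 1 * x\<close> matches the affine substitution rule for
    \<open>lborel\<close>.\<close>
  have shift: "normal_density (a - v) \<sigma> (- v + 1 * x) * h (- v + 1 * x) = normal_density a \<sigma> x * h (x - v)" for x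
    by (simp add: normal_density_def algebra_simps)
  have "integrable lborel (\<lambda>x. normal_density a \<sigma> x * h (x - v))"
    using distributed_integrable[OF D, of "\<lambda>x. h (x - v)"] int by simp
  then have i1: "integrable lborel (\<lambda>x. normal_density (a - v) \<sigma> x * h x)"
    using lborel_integrable_real_affine_iff[of 1 "\<lambda>x. normal_density (a - v) \<sigma> x * h x" "- v"]
    unfolding shift by simp
  have eq: "normal_density a \<sigma> x * (exp (- x) * h x)
      = exp (- a + v / 2) * (normal_density (a - v) \<sigma> x * h x)" for x
    using tilt[of x] by (metis mult.assoc)
  have "integrable P (\<lambda>\<omega>. exp (- X \<omega>) * h (X \<omega>))"
    using distributed_integrable[OF D, of "\<lambda>x. exp (- x) * h x"] i1 unfolding eq by simp
  moreover have "(\<integral>\<omega>. exp (- X \<omega>) * h (X \<omega>) \<partial>P) = exp (- a + v / 2) * (\<integral>x. normal_density (a - v) \<sigma> x * h x \<partial>lborel)"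
    using distributed_integral[OF D, of "\<lambda>x. exp (- x) * h x"] unfolding eq by simp
  moreover have "(\<integral>x. normal_density (a - v) \<sigma> x * h x \<partial>lborel) = (\<integral>x. normal_density a \<sigma> x * h (x - v) \<partial>lborel)"
    using lborel_integral_real_affine[of 1 "\<lambda>x. normal_density (a - v) \<sigma> x * h x" "- v"]
    unfolding shift by simp
  moreover have "\<dots> = (\<integral>\<omega>. h (X \<omega> - v) \<partial>P)"
    using distributed_integral[OF D, of "\<lambda>x. h (x - v)"] by simp
  ultimately show ?thesis by (simp add: has_bochner_integral_iff)
qed

text \<open>From \<open>ln t \<le> t - 1\<close> at \<open>t = x / q\<close>. Exponential moments
  thereby dominate all powers; the constant \<open>q powr q\<close> enters only finiteness
  statements, never the final constants.\<close>

lemma powr_le_const_mult_exp: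
  fixes x q :: real
  assumes "q > 0" "x \<ge> 0"
  shows "x powr q \<le> q powr q * exp x"
proof (cases "x = 0")
  case False
  then have x: "x > 0" using assms by auto
  have "ln (x / q) \<le> x / q - 1" using x assms by (intro ln_le_minus_one) auto
  then have "q * ln (x / q) \<le> q * (x / q)" using assms by (intro mult_left_mono) auto
  then have "q * ln x \<le> q * ln q + x"
    using x assms by (simp add: ln_div algebra_simps)
  then have "exp (q * ln x) \<le> exp (q * ln q) * exp x" by (simp flip: exp_add)
  then show ?thesis using x assms by (simp add: powr_def)
qed simp

text \<open>The larger exponential would do as Lipschitz factor; the sum is symmetric and splits
  under expectation into an untilted and a tilted part. The arguments may have any sign, as a
  Gaussian potential requires.\<close>

lemma abs_exp_minus_diff_le:
  fixes x y :: real
  shows "\<bar>exp (- x) - exp (- y)\<bar> \<le> (exp (- x) + exp (- y)) * \<bar>x - y\<bar>"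
proof -
  have *: "\<bar>exp (- x) - exp (- y)\<bar> \<le> (exp (- x) + exp (- y)) * \<bar>x - y\<bar>" if "x \<le> y" for x y :: real
  proof -
    have "exp (- x) - exp (- y) = exp (- x) * (1 - exp (- (y - x)))"
      by (simp add: algebra_simps flip: exp_add)
    also have "\<dots> \<le> exp (- x) * (y - x)"
      using exp_ge_add_one_self[of "- (y - x)"] by (intro mult_left_mono) (linarith, simp)
    also have "\<dots> \<le> (exp (- x) + exp (- y)) * (y - x)"
      using that by (intro mult_right_mono) auto
    finally show ?thesis using that by (simp add: abs_of_nonneg abs_of_nonpos)
  qed
  show ?thesis
    using *[of x y] *[of y x] by (cases "x \<le> y") (simp_all add: abs_minus_commute add.commute)
qed

text \<open>The leading \<open>1\<close> pays for the untilted weight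
  \<open>exp (- \<phi>) \<le> 1\<close>, and \<open>exp (B + K / 2)\<close> for the mass of the
  tilted law. For \<open>K \<ge> 0\<close> the bracket majorises both \<open>1 + 4 * sqrt K\<close>,
  which arises from first moments, and \<open>2 + 2 * K\<close>, which arises from second
  moments.\<close>

definition tilt_const :: "real \<Rightarrow> real \<Rightarrow> real" where
  "tilt_const B K = 1 + exp (B + K / 2) * (2 + 2 * K + 4 * sqrt K)"

section \<open>Moments of normal variables and of their exponentials\<close>

context prob_space
begin

lemma normal_rv_moments:
  assumes X: "normal_rv M X a v"
  shows normal_rv_mean: "has_bochner_integral M X a"
    and normal_rv_variance: "has_bochner_integral M (\<lambda>\<omega>. (X \<omega> - a)\<^sup>2) v"
    and normal_rv_abs_moment: "has_bochner_integral M (\<lambda>\<omega>. \<bar>X \<omega> - a\<bar>) (sqrt (2 * v / pi))"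
proof -
  have [measurable]: "X \<in> borel_measurable M" using assms by (auto simp: normal_rv_def)
  have "has_bochner_integral M X a \<and> has_bochner_integral M (\<lambda>\<omega>. (X \<omega> - a)\<^sup>2) v \<and>
    has_bochner_integral M (\<lambda>\<omega>. \<bar>X \<omega> - a\<bar>) (sqrt (2 * v / pi))"
  proof (cases "v = 0")
    case True
    then have AE: "AE \<omega> in M. X \<omega> = a" using assms by (auto simp: normal_rv_def)
    have const: "has_bochner_integral M (\<lambda>\<omega>. c) c" for c :: real
      by (simp add: has_bochner_integral_iff prob_space)
    show ?thesis
      using True AE const[of a] const[of 0]
      by (auto intro!: has_bochner_integral_cong_AE[THEN iffD2, OF _ _ _ const]
        has_bochner_integral_cong_AE[THEN iffD2, OF _ _ _ has_bochner_integral_zero])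
  next
    case False
    define \<sigma> where "\<sigma> = sqrt v"
    have v: "v = \<sigma>\<^sup>2" "\<sigma> > 0" using False assms by (auto simp: normal_rv_def \<sigma>_def)
    have D: "distributed M lborel X (\<lambda>x. ennreal (normal_density a \<sigma> x))"
      using False assms by (auto simp: normal_rv_def \<sigma>_def)
    \<comment> \<open>Moments of \<open>X\<close> are moments of the normal density; the formulas
      for these are indexed by half the order, hence the \<open>1\<close> and \<open>0\<close>
      below.\<close>
    have transfer: "has_bochner_integral M (\<lambda>\<omega>. h (X \<omega>)) c"
      if "has_bochner_integral lborel (\<lambda>x. normal_density a \<sigma> x * h x) c"
        and [measurable]: "h \<in> borel_measurable borel" for h :: "real \<Rightarrow> real" and c
      using that distributed_integrable[OF D, of h] distributed_integral[OF D, of h]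
      by (simp add: has_bochner_integral_iff)
    have "has_bochner_integral M (\<lambda>\<omega>. (X \<omega> - a) ^ (2 * 1)) (fact (2 * 1) / ((2 / \<sigma>\<^sup>2)^1 * fact 1))"
      using normal_moment_even[OF v(2), of a 1] by (rule transfer) simp
    moreover have "has_bochner_integral M (\<lambda>\<omega>. \<bar>X \<omega> - a\<bar> ^ (2 * 0 + 1)) (2^0 * \<sigma>^(2 * 0 + 1) * fact 0 * sqrt (2 / pi))"
      using normal_moment_abs_odd[OF v(2), of a 0] by (rule transfer) simp
    moreover have "has_bochner_integral M (\<lambda>\<omega>. X \<omega>) a"
      using normal_moment_nz_1[OF v(2), of a] by (rule transfer) simp
    moreover have "\<sigma> * sqrt (2 / pi) = sqrt (2 * v / pi)"
      using v by (simp add: real_sqrt_mult real_sqrt_divide)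
    ultimately show ?thesis using v by (simp add: fact_numeral)
  qed
  then show "has_bochner_integral M X a" "has_bochner_integral M (\<lambda>\<omega>. (X \<omega> - a)\<^sup>2) v"
    "has_bochner_integral M (\<lambda>\<omega>. \<bar>X \<omega> - a\<bar>) (sqrt (2 * v / pi))" by auto
qed

lemma normal_rv_uminus:
  assumes X: "normal_rv M X a v"
  shows "normal_rv M (\<lambda>\<omega>. - X \<omega>) (- a) v"
proof -
  show ?thesis
    using assms normal_density_affine[of X a "sqrt v" "-1" 0]
    by (auto simp: normal_rv_def)
qed

text \<open>The tilting identity for the constant function \<open>1\<close>.\<close>

lemma normal_rv_exp:
  assumes X: "normal_rv M X a v"
  shows "has_bochner_integral M (\<lambda>\<omega>. exp (- X \<omega>)) (exp (- a + v / 2))"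
proof -
  have "has_bochner_integral M (\<lambda>\<omega>. exp (- X \<omega>) * 1) (exp (- a + v / 2) * (\<integral>\<omega>. 1 \<partial>M))"
    by (rule normal_rv_tilt[OF X]) simp_all
  moreover have "(\<integral>\<omega>. 1 \<partial>M) = (1 :: real)" by (simp add: prob_space)
  ultimately show ?thesis by (simp only: mult_1_right)
qed

text \<open>The exponentials of \<open>X\<close> and \<open>- X\<close> dominate every power of the
  error. The bound involves only \<open>q\<close>, \<open>B\<close> and \<open>K\<close>, hence is
  uniform over the points at which a process is evaluated.\<close>

lemma normal_rv_powr_moment:
  assumes X: "normal_rv M X a v" and v: "v \<le> K"
    and \<phi>: "\<bar>\<phi> - a\<bar> \<le> B" and q: "q > 0"
  shows normal_rv_powr_integrable: "integrable M (\<lambda>\<omega>. \<bar>\<phi> - X \<omega>\<bar> powr q)"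
    and normal_rv_powr_le: "(\<integral>\<omega>. \<bar>\<phi> - X \<omega>\<bar> powr q \<partial>M) \<le> q powr q * (2 * exp (B + K / 2))"
proof -
  have [measurable]: "X \<in> borel_measurable M" using X by (auto simp: normal_rv_def)
  have 1: "has_bochner_integral M (\<lambda>\<omega>. exp (- X \<omega>)) (exp (- a + v / 2))"
    and 2: "has_bochner_integral M (\<lambda>\<omega>. exp (X \<omega>)) (exp (a + v / 2))"
    using normal_rv_exp[OF X]
      normal_rv_exp[OF normal_rv_uminus[OF X]] by auto
  \<comment> \<open>\<open>exp \<bar>t\<bar> \<le> exp t + exp (- t)\<close> at
    \<open>t = \<phi> - X\<close>, scaled by the constant that bounds a power by an
    exponential.\<close>
  define E where "E \<omega> = q powr q * (exp \<phi> * exp (- X \<omega>) + exp (- \<phi>) * exp (X \<omega>))" for \<omega>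
  have E: "has_bochner_integral M E (q powr q * (exp \<phi> * exp (- a + v / 2) + exp (- \<phi>) * exp (a + v / 2)))"
    unfolding E_def by (intro has_bochner_integral_mult_right has_bochner_integral_add 1 2)
  have le: "\<bar>\<phi> - X \<omega>\<bar> powr q \<le> E \<omega>" for \<omega>
  proof -
    have "\<bar>\<phi> - X \<omega>\<bar> powr q \<le> q powr q * exp \<bar>\<phi> - X \<omega>\<bar>"
      using q by (intro powr_le_const_mult_exp) auto
    also have "\<dots> \<le> E \<omega>"
      unfolding E_def using q
      by (intro mult_left_mono) (auto simp: abs_if add_nonneg_nonneg simp flip: exp_add)
    finally show ?thesis .
  qed
  have iE: "integrable M E" using E by (simp add: has_bochner_integral_iff)
  show "integrable M (\<lambda>\<omega>. \<bar>\<phi> - X \<omega>\<bar> powr q)"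
    by (rule Bochner_Integration.integrable_bound[OF iE]) (use le in \<open>auto intro: order_trans[OF le abs_ge_self]\<close>)
  have "(\<integral>\<omega>. \<bar>\<phi> - X \<omega>\<bar> powr q \<partial>M) \<le> (\<integral>\<omega>. E \<omega> \<partial>M)"
    by (rule integral_mono'[OF iE le]) (auto simp: E_def intro!: mult_nonneg_nonneg add_nonneg_nonneg)
  also have "\<dots> = q powr q * (exp (\<phi> - a + v / 2) + exp (- (\<phi> - a) + v / 2))"
    using E by (simp add: has_bochner_integral_iff algebra_simps flip: exp_add)
  also have "\<dots> \<le> q powr q * (exp (B + K / 2) + exp (B + K / 2))"
  proof -
    have "exp (\<phi> - a + v / 2) \<le> exp (B + K / 2)" "exp (- (\<phi> - a) + v / 2) \<le> exp (B + K / 2)"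
      unfolding exp_le_cancel_iff using v \<phi> by linarith+
    then show ?thesis by (intro mult_left_mono add_mono) auto
  qed
  finally show "(\<integral>\<omega>. \<bar>\<phi> - X \<omega>\<bar> powr q \<partial>M) \<le> q powr q * (2 * exp (B + K / 2))" by simp
qed

text \<open>Absorbs the mean shift \<open>v\<close> caused by tilting into the first absolute moment.\<close>

lemma normal_rv_sqrt_variance_le:
  assumes X: "normal_rv M X a v"
  shows "sqrt v \<le> 4 * (\<integral>\<omega>. \<bar>\<phi> - X \<omega>\<bar> \<partial>M)"
proof -
  have v: "v \<ge> 0" using X by (auto simp: normal_rv_def)
  note mean = normal_rv_mean[OF X] and dev = normal_rv_abs_moment[OF X]
  have iX: "integrable M X" using mean by (auto simp: has_bochner_integral_iff)
  have i\<phi>: "integrable M (\<lambda>\<omega>. \<bar>\<phi> - X \<omega>\<bar>)" using iX by auto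
  \<comment> \<open>The bias is at most the first moment of the error, so recentring from
    \<open>\<phi>\<close> to the mean \<open>a\<close> costs a factor two.\<close>
  have "\<phi> - a = (\<integral>\<omega>. \<phi> - X \<omega> \<partial>M)"
    using mean iX by (simp add: has_bochner_integral_iff prob_space)
  then have mean_le: "\<bar>\<phi> - a\<bar> \<le> (\<integral>\<omega>. \<bar>\<phi> - X \<omega>\<bar> \<partial>M)"
    using integral_abs_bound[of M "\<lambda>\<omega>. \<phi> - X \<omega>"] by simp
  \<comment> \<open>By \<open>pi < 4\<close>, the standard deviation is at most twice the mean
    absolute deviation; together with the recentring this gives the factor four.\<close>
  have "1 \<le> sqrt (4 * (2 / pi))"
    using pi_less_4 pi_gt_zero by (simp add: field_simps)
  then have "1 \<le> 2 * sqrt (2 / pi)" unfolding real_sqrt_mult real_sqrt_four .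
  then have "sqrt v * 1 \<le> sqrt v * (2 * sqrt (2 / pi))" using v by (intro mult_left_mono) auto
  also have "\<dots> = 2 * (\<integral>\<omega>. \<bar>X \<omega> - a\<bar> \<partial>M)"
    using dev by (simp add: has_bochner_integral_iff real_sqrt_mult real_sqrt_divide)
  also have "(\<integral>\<omega>. \<bar>X \<omega> - a\<bar> \<partial>M) \<le> (\<integral>\<omega>. \<bar>\<phi> - X \<omega>\<bar> + \<bar>\<phi> - a\<bar> \<partial>M)"
    using iX i\<phi> by (intro integral_mono') auto
  also have "\<dots> = (\<integral>\<omega>. \<bar>\<phi> - X \<omega>\<bar> \<partial>M) + \<bar>\<phi> - a\<bar>"
    using i\<phi> by (simp add: prob_space)
  finally show ?thesis using mean_le by simp
qed

text \<open>Bias-variance decomposition: the second moment about \<open>\<phi>\<close> is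
  \<open>v + (\<phi> - a)\<^sup>2\<close>.\<close>

lemma normal_rv_variance_le:
  assumes X: "normal_rv M X a v"
  shows normal_rv_sq_integrable: "integrable M (\<lambda>\<omega>. (\<phi> - X \<omega>)\<^sup>2)"
    and "v \<le> (\<integral>\<omega>. (\<phi> - X \<omega>)\<^sup>2 \<partial>M)"
proof -
  have "has_bochner_integral M (\<lambda>\<omega>. (X \<omega> - a)\<^sup>2 - 2 * (\<phi> - a) * (X \<omega> - a) + (\<phi> - a)\<^sup>2)
    (v - 2 * (\<phi> - a) * (a - a) + (\<phi> - a)\<^sup>2)"
    using normal_rv_mean[OF X] normal_rv_variance[OF X]
    by (auto simp: has_bochner_integral_iff prob_space)
  moreover have "(X \<omega> - a)\<^sup>2 - 2 * (\<phi> - a) * (X \<omega> - a) + (\<phi> - a)\<^sup>2 = (\<phi> - X \<omega>)\<^sup>2" for \<omega>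
    by (simp add: power2_eq_square algebra_simps)
  ultimately have "has_bochner_integral M (\<lambda>\<omega>. (\<phi> - X \<omega>)\<^sup>2) (v + (\<phi> - a)\<^sup>2)" by simp
  then show "integrable M (\<lambda>\<omega>. (\<phi> - X \<omega>)\<^sup>2)" "v \<le> (\<integral>\<omega>. (\<phi> - X \<omega>)\<^sup>2 \<partial>M)"
    by (auto simp: has_bochner_integral_iff)
qed

text \<open>The error is weighted by \<open>exp (- \<phi>) + exp (- X)\<close>. The first weight is
  at most one because \<open>\<phi> \<ge> 0\<close>. The second is removed by tilting, and the
  resulting shift \<open>v\<close> is absorbed into the moment of the error itself, using
  \<open>v \<le> K\<close>.\<close>

lemma normal_rv_exp_Lipschitz:
  assumes X: "normal_rv M X a v" and v: "v \<le> K"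
    and \<phi>: "\<phi> \<ge> 0" "\<bar>\<phi> - a\<bar> \<le> B"
  shows normal_rv_exp_diff_le: "\<bar>exp (- \<phi>) - (\<integral>\<omega>. exp (- X \<omega>) \<partial>M)\<bar> \<le> tilt_const B K * (\<integral>\<omega>. \<bar>\<phi> - X \<omega>\<bar> \<partial>M)"
    and normal_rv_exp_diff_sq_le: "(\<integral>\<omega>. (exp (- \<phi> / 2) - exp (- X \<omega> / 2))\<^sup>2 \<partial>M)
      \<le> tilt_const B K * (\<integral>\<omega>. (\<phi> - X \<omega>)\<^sup>2 \<partial>M)"
proof -
  have [measurable]: "X \<in> borel_measurable M" and v0: "v \<ge> 0" using X by (auto simp: normal_rv_def)
  have K: "K \<ge> 0" using v v0 by simp
  have iX: "integrable M X" using normal_rv_mean[OF X] by (auto simp: has_bochner_integral_iff)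
  have i1: "integrable M (\<lambda>\<omega>. \<bar>\<phi> - X \<omega>\<bar>)" using iX by auto
  have i2: "integrable M (\<lambda>\<omega>. (c - X \<omega>)\<^sup>2)" for c by (rule normal_rv_sq_integrable[OF X])
  \<comment> \<open>Since \<open>\<phi> \<ge> 0\<close>, the bound on the bias gives
    \<open>- a \<le> B\<close>.\<close>
  have exp_a: "exp (- a + v / 2) \<le> exp (B + K / 2)" using v \<phi> by simp
  have exp_\<phi>: "exp (- \<phi>) \<le> 1" using \<phi> by simp
  have sv: "sqrt v \<le> 4 * (\<integral>\<omega>. \<bar>\<phi> - X \<omega>\<bar> \<partial>M)" by (rule normal_rv_sqrt_variance_le[OF X])
  have v_le: "v \<le> (\<integral>\<omega>. (\<phi> - X \<omega>)\<^sup>2 \<partial>M)" by (rule normal_rv_variance_le[OF X])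

  define I1 where "I1 = (\<integral>\<omega>. \<bar>\<phi> - X \<omega>\<bar> \<partial>M)"
  define I2 where "I2 = (\<integral>\<omega>. (\<phi> - X \<omega>)\<^sup>2 \<partial>M)"
  have I0: "I1 \<ge> 0" "I2 \<ge> 0" unfolding I1_def I2_def by (auto intro!: Bochner_Integration.integral_nonneg)

  have t1: "has_bochner_integral M (\<lambda>\<omega>. exp (- X \<omega>) * \<bar>\<phi> - X \<omega>\<bar>)
      (exp (- a + v / 2) * (\<integral>\<omega>. \<bar>\<phi> - (X \<omega> - v)\<bar> \<partial>M))"
    using iX by (intro normal_rv_tilt[OF X]) auto
  have "(\<integral>\<omega>. \<bar>\<phi> - (X \<omega> - v)\<bar> \<partial>M) \<le> (\<integral>\<omega>. \<bar>\<phi> - X \<omega>\<bar> + v \<partial>M)"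
    using i1 v0 by (intro integral_mono') auto
  also have "\<dots> = I1 + v" using i1 by (simp add: prob_space I1_def)
  also have "\<dots> \<le> I1 + sqrt K * (4 * I1)"
  proof -
    \<comment> \<open>One factor is bounded by \<open>sqrt K\<close>, the other by the first moment,
      so that the shift becomes linear in \<open>I1\<close>.\<close>
    have "sqrt v * sqrt v \<le> sqrt K * (4 * I1)"
      using v sv K v0 I0 unfolding I1_def by (intro mult_mono) auto
    then show ?thesis using v0 by simp
  qed
  finally have "(\<integral>\<omega>. exp (- X \<omega>) * \<bar>\<phi> - X \<omega>\<bar> \<partial>M) \<le> exp (B + K / 2) * (I1 + sqrt K * (4 * I1))"
    using t1 exp_a by (auto simp: has_bochner_integral_iff intro!: mult_mono)
  also have "\<dots> \<le> (tilt_const B K - 1) * I1"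
    using I0 K by (simp add: tilt_const_def algebra_simps)
  finally have t1_le: "(\<integral>\<omega>. exp (- X \<omega>) * \<bar>\<phi> - X \<omega>\<bar> \<partial>M) \<le> (tilt_const B K - 1) * I1" .

  have iE: "integrable M (\<lambda>\<omega>. exp (- X \<omega>))"
    using normal_rv_exp[OF X] by (auto simp: has_bochner_integral_iff)
  have it1: "integrable M (\<lambda>\<omega>. exp (- X \<omega>) * \<bar>\<phi> - X \<omega>\<bar>)"
    using t1 by (auto simp: has_bochner_integral_iff)
  have "exp (- \<phi>) - (\<integral>\<omega>. exp (- X \<omega>) \<partial>M) = (\<integral>\<omega>. exp (- \<phi>) - exp (- X \<omega>) \<partial>M)"
    using iE by (simp add: prob_space)
  also have "\<bar>\<dots>\<bar> \<le> (\<integral>\<omega>. \<bar>exp (- \<phi>) - exp (- X \<omega>)\<bar> \<partial>M)" by (rule integral_abs_bound)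
  also have "\<dots> \<le> (\<integral>\<omega>. \<bar>\<phi> - X \<omega>\<bar> + exp (- X \<omega>) * \<bar>\<phi> - X \<omega>\<bar> \<partial>M)"
  proof (rule integral_mono')
    fix \<omega>
    have "(exp (- \<phi>) + exp (- X \<omega>)) * \<bar>\<phi> - X \<omega>\<bar> \<le> (1 + exp (- X \<omega>)) * \<bar>\<phi> - X \<omega>\<bar>"
      using exp_\<phi> by (intro mult_right_mono) auto
    then show "\<bar>exp (- \<phi>) - exp (- X \<omega>)\<bar> \<le> \<bar>\<phi> - X \<omega>\<bar> + exp (- X \<omega>) * \<bar>\<phi> - X \<omega>\<bar>"
      using abs_exp_minus_diff_le[of \<phi> "X \<omega>"] by (simp add: distrib_right)
  qed (use i1 it1 in auto)
  also have "\<dots> = I1 + (\<integral>\<omega>. exp (- X \<omega>) * \<bar>\<phi> - X \<omega>\<bar> \<partial>M)" using i1 it1 by (simp add: I1_def)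
  also have "\<dots> \<le> tilt_const B K * I1" using t1_le by (simp add: algebra_simps)
  finally show "\<bar>exp (- \<phi>) - (\<integral>\<omega>. exp (- X \<omega>) \<partial>M)\<bar> \<le> tilt_const B K * (\<integral>\<omega>. \<bar>\<phi> - X \<omega>\<bar> \<partial>M)"
    by (simp add: I1_def)

  have t2: "has_bochner_integral M (\<lambda>\<omega>. exp (- X \<omega>) * (\<phi> - X \<omega>)\<^sup>2)
      (exp (- a + v / 2) * (\<integral>\<omega>. (\<phi> - (X \<omega> - v))\<^sup>2 \<partial>M))"
    \<comment> \<open>Tilting moves the centre from \<open>\<phi>\<close> to
      \<open>\<phi> + v\<close>, which is why \<open>i2\<close> allows an arbitrary centre.\<close>
    using i2[of "\<phi> + v"] by (intro normal_rv_tilt[OF X]) (auto simp: algebra_simps)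
  have "(\<integral>\<omega>. (\<phi> - (X \<omega> - v))\<^sup>2 \<partial>M) \<le> (\<integral>\<omega>. 2 * (\<phi> - X \<omega>)\<^sup>2 + 2 * v\<^sup>2 \<partial>M)"
  proof (rule integral_mono')
    fix \<omega>
    have "0 \<le> (\<phi> - X \<omega> - v)\<^sup>2" by simp
    then show "(\<phi> - (X \<omega> - v))\<^sup>2 \<le> 2 * (\<phi> - X \<omega>)\<^sup>2 + 2 * v\<^sup>2"
      by (simp add: power2_eq_square algebra_simps)
  qed (use i2 in auto)
  also have "\<dots> = 2 * I2 + 2 * v\<^sup>2" using i2 by (simp add: prob_space I2_def)
  \<comment> \<open>Again one factor \<open>v\<close> is bounded by \<open>K\<close>, the other by
    the second moment.\<close>
  also have "v\<^sup>2 \<le> K * I2" unfolding power2_eq_square[of v] I2_def using v v_le v0 K by (intro mult_mono) auto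
  finally have "(\<integral>\<omega>. exp (- X \<omega>) * (\<phi> - X \<omega>)\<^sup>2 \<partial>M) \<le> exp (B + K / 2) * (2 * I2 + 2 * (K * I2))"
    using t2 exp_a by (auto simp: has_bochner_integral_iff intro!: mult_mono)
  also have "\<dots> \<le> (tilt_const B K - 1) * I2"
    using I0 K by (simp add: tilt_const_def algebra_simps)
  finally have t2_le: "(\<integral>\<omega>. exp (- X \<omega>) * (\<phi> - X \<omega>)\<^sup>2 \<partial>M) \<le> (tilt_const B K - 1) * I2" .
  have it2: "integrable M (\<lambda>\<omega>. exp (- X \<omega>) * (\<phi> - X \<omega>)\<^sup>2)"
    using t2 by (auto simp: has_bochner_integral_iff)
  have "(\<integral>\<omega>. (exp (- \<phi> / 2) - exp (- X \<omega> / 2))\<^sup>2 \<partial>M)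
      \<le> (\<integral>\<omega>. (\<phi> - X \<omega>)\<^sup>2 + exp (- X \<omega>) * (\<phi> - X \<omega>)\<^sup>2 \<partial>M)"
  proof (rule integral_mono')
    fix \<omega>
    let ?p = "exp (- \<phi> / 2)" and ?r = "exp (- X \<omega> / 2)"
    \<comment> \<open>With halved exponents, squaring returns \<open>exp (- \<phi>)\<close> and
      \<open>exp (- X)\<close>, and the factor \<open>1 / 4\<close> pays for the square of the
      sum.\<close>
    have "\<bar>?p - ?r\<bar> \<le> (?p + ?r) * \<bar>\<phi> / 2 - X \<omega> / 2\<bar>"
      using abs_exp_minus_diff_le[of "\<phi> / 2" "X \<omega> / 2"] by simp
    then have "\<bar>?p - ?r\<bar>\<^sup>2 \<le> ((?p + ?r) * \<bar>\<phi> / 2 - X \<omega> / 2\<bar>)\<^sup>2" by (intro power_mono) auto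
    also have "\<dots> = ((?p + ?r)\<^sup>2 / 4) * (\<phi> - X \<omega>)\<^sup>2"
      by (simp add: power_mult_distrib diff_divide_distrib[symmetric] power_divide)
    also have "\<dots> \<le> (1 + exp (- X \<omega>)) * (\<phi> - X \<omega>)\<^sup>2"
    proof (rule mult_right_mono)
      have "(?p + ?r)\<^sup>2 \<le> 2 * ?p\<^sup>2 + 2 * ?r\<^sup>2"
        using zero_le_power2[of "?p - ?r"] unfolding power2_diff power2_sum by simp
      also have "\<dots> = 2 * exp (- \<phi>) + 2 * exp (- X \<omega>)" by (simp flip: exp_double)
      finally show "(?p + ?r)\<^sup>2 / 4 \<le> 1 + exp (- X \<omega>)" using exp_\<phi> exp_ge_zero[of "- X \<omega>"] by linarith
    qed simp
    finally show "(?p - ?r)\<^sup>2 \<le> (\<phi> - X \<omega>)\<^sup>2 + exp (- X \<omega>) * (\<phi> - X \<omega>)\<^sup>2"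
      by (simp add: distrib_right)
  qed (use i2 it2 in auto)
  also have "\<dots> = I2 + (\<integral>\<omega>. exp (- X \<omega>) * (\<phi> - X \<omega>)\<^sup>2 \<partial>M)" using i2 it2 by (simp add: I2_def)
  also have "\<dots> \<le> tilt_const B K * I2" using t2_le by (simp add: algebra_simps)
  finally show "(\<integral>\<omega>. (exp (- \<phi> / 2) - exp (- X \<omega> / 2))\<^sup>2 \<partial>M) \<le> tilt_const B K * (\<integral>\<omega>. (\<phi> - X \<omega>)\<^sup>2 \<partial>M)"
    by (simp add: I2_def)
qed

text \<open>Young's inequality for \<open>X powr q\<close> divided by its mean, then integrated. The
  same pointwise inequality with divisor \<open>1\<close> gives integrability of the lower
  power.\<close>

lemma Lyapunov_inequality:
  fixes X :: "'a \<Rightarrow> real"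
  assumes [measurable]: "X \<in> borel_measurable M" and X0: "\<And>\<omega>. X \<omega> \<ge> 0"
    and pq: "0 < p" "p \<le> q" and int: "integrable M (\<lambda>\<omega>. X \<omega> powr q)"
  shows Lyapunov_integrable: "integrable M (\<lambda>\<omega>. X \<omega> powr p)"
    and Lyapunov_le: "(\<integral>\<omega>. X \<omega> powr p \<partial>M) \<le> (\<integral>\<omega>. X \<omega> powr q \<partial>M) powr (p / q)"
proof -
  define s where "s = (\<integral>\<omega>. X \<omega> powr q \<partial>M)"
  have young: "x powr p / c powr (p / q) \<le> p / q * (x powr q / c) + (1 - p / q)" if "x \<ge> 0" "c > 0" for x c
  proof (cases "x = 0")
    case False
    have "(x powr q / c) powr (p / q) * 1 powr (1 - p / q) \<le> p / q * (x powr q / c) + (1 - p / q) * 1"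
      using pq that False by (intro Youngs_inequality_0) auto
    moreover have "(x powr q / c) powr (p / q) = x powr p / c powr (p / q)"
      using pq that by (simp add: powr_divide powr_powr)
    ultimately show ?thesis by simp
  qed (use pq in simp)
  have iY: "integrable M (\<lambda>\<omega>. p / q * (X \<omega> powr q / c) + (1 - p / q))" for c using int by auto
  show int_p: "integrable M (\<lambda>\<omega>. X \<omega> powr p)"
    by (rule Bochner_Integration.integrable_bound[OF iY[of 1]])
      (use young[OF X0, of 1] in \<open>auto intro!: order_trans[OF _ abs_ge_self]\<close>)
  show "(\<integral>\<omega>. X \<omega> powr p \<partial>M) \<le> (\<integral>\<omega>. X \<omega> powr q \<partial>M) powr (p / q)"
  proof (cases "s = 0")
    \<comment> \<open>Division by \<open>s\<close> is meaningless here, but \<open>X\<close> then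
      vanishes almost surely.\<close>
    case True
    then have "AE \<omega> in M. X \<omega> powr q = 0"
      using integral_nonneg_eq_0_iff_AE[OF int] unfolding s_def by auto
    then have "AE \<omega> in M. X \<omega> powr p = 0" by eventually_elim (auto simp: powr_eq_0_iff)
    then have "(\<integral>\<omega>. X \<omega> powr p \<partial>M) = 0" by (rule integral_eq_zero_AE)
    then show ?thesis by simp
  next
    case False
    then have s: "s > 0"
      unfolding s_def by (simp add: order_less_le Bochner_Integration.integral_nonneg)
    have "(\<integral>\<omega>. X \<omega> powr p \<partial>M) / s powr (p / q) = (\<integral>\<omega>. X \<omega> powr p / s powr (p / q) \<partial>M)" by simp
    also have "\<dots> \<le> (\<integral>\<omega>. p / q * (X \<omega> powr q / s) + (1 - p / q) \<partial>M)"
      using int_p iY young[OF X0 s] by (intro integral_mono) auto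
    also have "\<dots> = p / q * (s / s) + (1 - p / q)"
      using int by (simp add: prob_space s_def)
    also have "\<dots> = 1" using s by simp
    finally show ?thesis using s by (simp add: s_def[symmetric] pos_divide_le_eq)
  qed
qed

end

section \<open>Posteriors of random potentials\<close>

text \<open>\<open>D \<omega> u\<close> is the pointwise error of the emulator. The expectations in \<open>mean_stable\<close> and
  \<open>sq_stable\<close> carry no exponent \<open>\<delta>\<close>, which is what makes the constants independent of it.\<close>

locale random_potential = prior: prob_space \<mu>\<^sub>0 + noise: prob_space P
  for \<mu>\<^sub>0 :: "'u measure" and P :: "'w measure" +
  fixes \<Phi> :: "'u \<Rightarrow> real" and \<Psi> D :: "'w \<Rightarrow> 'u \<Rightarrow> real" and M A C :: real
  assumes \<Phi>_meas[measurable]: "\<Phi> \<in> borel_measurable \<mu>\<^sub>0"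
    and \<Phi>_le: "u \<in> space \<mu>\<^sub>0 \<Longrightarrow> \<Phi> u \<le> M"
    and \<Psi>_meas: "(\<lambda>(\<omega>, u). \<Psi> \<omega> u) \<in> borel_measurable (P \<Otimes>\<^sub>M \<mu>\<^sub>0)"
    and D_meas: "(\<lambda>(\<omega>, u). D \<omega> u) \<in> borel_measurable (P \<Otimes>\<^sub>M \<mu>\<^sub>0)"
    and D_nonneg: "0 \<le> D \<omega> u"
    and exp_\<Phi>_integrable: "integrable \<mu>\<^sub>0 (\<lambda>u. exp (- \<Phi> u))"
    and exp_\<Psi>_integrable: "u \<in> space \<mu>\<^sub>0 \<Longrightarrow> integrable P (\<lambda>\<omega>. exp (- \<Psi> \<omega> u))"
    and exp_\<Psi>_le: "u \<in> space \<mu>\<^sub>0 \<Longrightarrow> (\<integral>\<omega>. exp (- \<Psi> \<omega> u) \<partial>P) \<le> A"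
    and C_nonneg: "0 \<le> C"
    and mean_stable: "u \<in> space \<mu>\<^sub>0 \<Longrightarrow>
      \<bar>exp (- \<Phi> u) - (\<integral>\<omega>. exp (- \<Psi> \<omega> u) \<partial>P)\<bar> \<le> C * (\<integral>\<omega>. D \<omega> u \<partial>P)"
    and sq_stable: "u \<in> space \<mu>\<^sub>0 \<Longrightarrow>
      (\<integral>\<omega>. (exp (- \<Phi> u / 2) - exp (- \<Psi> \<omega> u / 2))\<^sup>2 \<partial>P) \<le> C * (\<integral>\<omega>. (D \<omega> u)\<^sup>2 \<partial>P)"
    and D_powr: "0 < q \<Longrightarrow> \<exists>B. \<forall>u\<in>space \<mu>\<^sub>0.
      integrable P (\<lambda>\<omega>. D \<omega> u powr q) \<and> (\<integral>\<omega>. D \<omega> u powr q \<partial>P) \<le> B"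
begin

section \<open>Product integrability and powers of the error\<close>

sublocale swap: pair_sigma_finite \<mu>\<^sub>0 P ..

text \<open>Joint measurability restated for composed arguments, so that it applies to sections and
  to the product in either order.\<close>

lemma \<Psi>_measurable[measurable (raw)]:
  assumes [measurable]: "f \<in> measurable N P" "g \<in> measurable N \<mu>\<^sub>0"
  shows "(\<lambda>x. \<Psi> (f x) (g x)) \<in> borel_measurable N"
  using measurable_compose[OF measurable_Pair[OF assms] \<Psi>_meas] by simp

lemma D_measurable[measurable (raw)]:
  assumes [measurable]: "f \<in> measurable N P" "g \<in> measurable N \<mu>\<^sub>0"
  shows "(\<lambda>x. D (f x) (g x)) \<in> borel_measurable N"
  using measurable_compose[OF measurable_Pair[OF assms] D_meas] by simp

text \<open>The available bounds concern expectations at fixed \<open>u\<close>, so Fubini's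
  criterion is applied with \<open>P\<close> as the inner integral and the prior as the outer
  one.\<close>

lemma integrable_product:
  fixes F :: "'w \<Rightarrow> 'u \<Rightarrow> real"
  assumes [measurable]: "(\<lambda>(u, \<omega>). F \<omega> u) \<in> borel_measurable (\<mu>\<^sub>0 \<Otimes>\<^sub>M P)"
    and F0: "\<And>\<omega> u. 0 \<le> F \<omega> u"
    and F: "\<And>u. u \<in> space \<mu>\<^sub>0 \<Longrightarrow> integrable P (\<lambda>\<omega>. F \<omega> u)"
    and bound: "integrable \<mu>\<^sub>0 h" "\<And>u. u \<in> space \<mu>\<^sub>0 \<Longrightarrow> (\<integral>\<omega>. F \<omega> u \<partial>P) \<le> h u"
  shows "integrable (\<mu>\<^sub>0 \<Otimes>\<^sub>M P) (\<lambda>(u, \<omega>). F \<omega> u)"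
proof (rule swap.Fubini_integrable)
  show "integrable \<mu>\<^sub>0 (\<lambda>u. \<integral>\<omega>. norm (case (u, \<omega>) of (u, \<omega>) \<Rightarrow> F \<omega> u) \<partial>P)"
  proof (rule Bochner_Integration.integrable_bound[OF bound(1)])
    show "AE u in \<mu>\<^sub>0. norm (\<integral>\<omega>. norm (case (u, \<omega>) of (u, \<omega>) \<Rightarrow> F \<omega> u) \<partial>P) \<le> norm (h u)"
      using bound(2) F0 by (auto simp: Bochner_Integration.integral_nonneg intro!: AE_I2 order_trans[OF _ abs_ge_self])
  qed measurable
  show "AE u in \<mu>\<^sub>0. integrable P (\<lambda>\<omega>. case (u, \<omega>) of (u, \<omega>) \<Rightarrow> F \<omega> u)"
    using F by auto
qed measurable

text \<open>The Bochner integral of a non-integrable function is \<open>0\<close>. Integrability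
  makes \<open>L2_norm\<close> of the error a genuine norm and allows integrals to be compared with
  it.\<close>

lemma Lq_error_integrable:
  assumes "q > 0"
  shows "integrable \<mu>\<^sub>0 (\<lambda>u. ((\<integral>\<omega>. D \<omega> u powr q \<partial>P) powr (1 / q))\<^sup>2)"
proof -
  obtain B where B: "\<And>u. u \<in> space \<mu>\<^sub>0 \<Longrightarrow> (\<integral>\<omega>. D \<omega> u powr q \<partial>P) \<le> B"
    using D_powr[OF assms] by auto
  show ?thesis
  proof (rule prior.integrable_const_bound)
    show "AE u in \<mu>\<^sub>0. norm (((\<integral>\<omega>. D \<omega> u powr q \<partial>P) powr (1 / q))\<^sup>2) \<le> (B powr (1 / q))\<^sup>2"
      using B assms
      by (auto intro!: AE_I2 power_mono powr_mono2 Bochner_Integration.integral_nonneg)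
  qed measurable
qed

text \<open>Lyapunov's inequality at a fixed point. It is applied with \<open>p = 1\<close> to the
  marginal and with \<open>p = 2\<close> to the sample approximation.\<close>

lemma moment_le_Lq_error:
  assumes "0 < p" "p \<le> q" "u \<in> space \<mu>\<^sub>0"
  shows "integrable P (\<lambda>\<omega>. D \<omega> u powr p)"
    and "(\<integral>\<omega>. D \<omega> u powr p \<partial>P) \<le> ((\<integral>\<omega>. D \<omega> u powr q \<partial>P) powr (1 / q)) powr p"
proof -
  have q: "integrable P (\<lambda>\<omega>. D \<omega> u powr q)" using D_powr[of q] assms by auto
  have m: "(\<lambda>\<omega>. D \<omega> u) \<in> borel_measurable P" using assms(3) by measurable
  show "integrable P (\<lambda>\<omega>. D \<omega> u powr p)"
    by (rule noise.Lyapunov_integrable[OF m D_nonneg assms(1,2) q])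
  show "(\<integral>\<omega>. D \<omega> u powr p \<partial>P) \<le> ((\<integral>\<omega>. D \<omega> u powr q \<partial>P) powr (1 / q)) powr p"
    using noise.Lyapunov_le[OF m D_nonneg assms(1,2) q] by (simp add: powr_powr)
qed

section \<open>The evidence and the two Hellinger estimates\<close>

lemma evidence_ge: "exp (- M) \<le> (\<integral>u. exp (- \<Phi> u) \<partial>\<mu>\<^sub>0)"
  using \<Phi>_le by (intro prior.integral_ge_const exp_\<Phi>_integrable AE_I2) auto

lemma evidence_pos: "0 < (\<integral>u. exp (- \<Phi> u) \<partial>\<mu>\<^sub>0)"
  using evidence_ge exp_gt_zero[of "- M"] by linarith

lemma sqrt_exp: "sqrt (exp x) = exp (x / 2)"
  by (rule real_sqrt_unique) (simp_all flip: exp_double)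

lemma exp_\<Psi>_product: "integrable (\<mu>\<^sub>0 \<Otimes>\<^sub>M P) (\<lambda>(u, \<omega>). exp (- \<Psi> \<omega> u))"
  using exp_\<Psi>_integrable exp_\<Psi>_le by (intro integrable_product[where h="\<lambda>_. A"]) auto

text \<open>Since \<open>sqrt f - sqrt g = (f - g) / (sqrt f + sqrt g)\<close>, the squared
  difference is at most \<open>(f - g)\<^sup>2 / f\<close>. The lower bound \<open>exp (- M)\<close>
  is used twice, for \<open>f\<close> and for the evidence, and the final square root turns the two
  factors \<open>exp M\<close> into one.\<close>

lemma hellinger_marginal_le:
  assumes "q \<ge> 1"
  shows "hellinger \<mu>\<^sub>0 (posterior \<mu>\<^sub>0 \<Phi>) (marginal_posterior P \<mu>\<^sub>0 \<Psi>)
    \<le> exp M * C * L2_norm \<mu>\<^sub>0 (\<lambda>u. (\<integral>\<omega>. D \<omega> u powr q \<partial>P) powr (1 / q))"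
proof -
  define f where "f u = exp (- \<Phi> u)" for u
  define g where "g u = (\<integral>\<omega>. exp (- \<Psi> \<omega> u) \<partial>P)" for u
  define R where "R u = (\<integral>\<omega>. D \<omega> u powr q \<partial>P) powr (1 / q)" for u
  let ?H = "hellinger \<mu>\<^sub>0 (posterior \<mu>\<^sub>0 \<Phi>) (marginal_posterior P \<mu>\<^sub>0 \<Psi>)"
  have [measurable]: "f \<in> borel_measurable \<mu>\<^sub>0" "g \<in> borel_measurable \<mu>\<^sub>0"
    unfolding f_def g_def by measurable
  have fi: "integrable \<mu>\<^sub>0 f" and Z: "0 < (\<integral>u. f u \<partial>\<mu>\<^sub>0)" "exp (- M) \<le> (\<integral>u. f u \<partial>\<mu>\<^sub>0)"
    using exp_\<Phi>_integrable evidence_pos evidence_ge by (auto simp: f_def[abs_def])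
  have gi: "integrable \<mu>\<^sub>0 g"
    using swap.integrable_fst'[OF exp_\<Psi>_product] by (simp add: g_def[abs_def])
  have f0: "0 < f u" and g0: "0 \<le> g u" for u
    by (auto simp: f_def g_def intro!: Bochner_Integration.integral_nonneg)
  have g_pos: "0 < g u" if "u \<in> space \<mu>\<^sub>0" for u
    unfolding g_def using exp_\<Psi>_integrable[OF that]
    by (rule noise.expectation_greater[of _ 0]) auto
  have W: "0 < (\<integral>u. g u \<partial>\<mu>\<^sub>0)"
    using gi g_pos by (intro prior.expectation_greater) auto
  have R2: "integrable \<mu>\<^sub>0 (\<lambda>u. (R u)\<^sup>2)"
    using Lq_error_integrable[of q] assms by (simp add: R_def)
  have post: "posterior \<mu>\<^sub>0 \<Phi> = density \<mu>\<^sub>0 (\<lambda>u. ennreal (f u / (\<integral>v. f v \<partial>\<mu>\<^sub>0)))"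
    by (simp add: posterior_def f_def)
  \<comment> \<open>Fubini identifies the mean of the random evidence with the evidence of the
    averaged density, so the marginal approximation is a normalised density as well.\<close>
  have "(\<integral>\<omega>. (\<integral>v. exp (- \<Psi> \<omega> v) \<partial>\<mu>\<^sub>0) \<partial>P) = (\<integral>v. g v \<partial>\<mu>\<^sub>0)"
    using swap.Fubini_integral[OF exp_\<Psi>_product] by (simp add: g_def)
  then have marg: "marginal_posterior P \<mu>\<^sub>0 \<Psi> = density \<mu>\<^sub>0 (\<lambda>u. ennreal (g u / (\<integral>v. g v \<partial>\<mu>\<^sub>0)))"
    by (simp add: marginal_posterior_def g_def)
  have "?H\<^sup>2 \<le> (\<integral>u. (sqrt (f u) - sqrt (g u))\<^sup>2 \<partial>\<mu>\<^sub>0) / (\<integral>u. f u \<partial>\<mu>\<^sub>0)"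
    unfolding post marg
    using f0 g0 by (intro prior.hellinger_density_sq_le fi gi Z W) (auto intro: less_imp_le)
  also have "\<dots> \<le> (\<integral>u. exp M * C\<^sup>2 * (R u)\<^sup>2 \<partial>\<mu>\<^sub>0) / exp (- M)"
  proof (rule frac_le)
    show "(\<integral>u. (sqrt (f u) - sqrt (g u))\<^sup>2 \<partial>\<mu>\<^sub>0) \<le> (\<integral>u. exp M * C\<^sup>2 * (R u)\<^sup>2 \<partial>\<mu>\<^sub>0)"
    proof (rule integral_mono')
      fix u assume u: "u \<in> space \<mu>\<^sub>0"
      have "\<bar>f u - g u\<bar> \<le> C * (\<integral>\<omega>. D \<omega> u \<partial>P)" using mean_stable[OF u] by (simp add: f_def g_def)
      also have "\<dots> \<le> C * R u"
        using moment_le_Lq_error(2)[of 1 q u] assms u C_nonneg D_nonneg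
        by (intro mult_left_mono) (simp_all add: R_def)
      finally have fg: "\<bar>f u - g u\<bar> \<le> C * R u" .
      have fM: "1 \<le> exp M * f u" using \<Phi>_le[OF u] by (simp add: f_def flip: exp_add)
      have "\<bar>sqrt (f u) - sqrt (g u)\<bar> * sqrt (f u) \<le> \<bar>sqrt (f u) - sqrt (g u)\<bar> * (sqrt (f u) + sqrt (g u))"
        using g0[of u] by (intro mult_left_mono) auto
      also have "\<dots> = \<bar>(sqrt (f u) - sqrt (g u)) * (sqrt (f u) + sqrt (g u))\<bar>"
        using f0[of u] g0[of u] by (simp add: abs_mult)
      also have "(sqrt (f u) - sqrt (g u)) * (sqrt (f u) + sqrt (g u)) = f u - g u"
        using f0[of u] g0[of u] by (simp add: algebra_simps)
      finally have "(\<bar>sqrt (f u) - sqrt (g u)\<bar> * sqrt (f u))\<^sup>2 \<le> (C * R u)\<^sup>2"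
        using fg f0[of u] by (intro power_mono) auto
      then have sq: "(sqrt (f u) - sqrt (g u))\<^sup>2 * f u \<le> C\<^sup>2 * (R u)\<^sup>2"
        using f0[of u] by (simp add: power_mult_distrib)
      have "(sqrt (f u) - sqrt (g u))\<^sup>2 * 1 \<le> (sqrt (f u) - sqrt (g u))\<^sup>2 * (exp M * f u)"
        using fM by (intro mult_left_mono) auto
      also have "\<dots> \<le> exp M * (C\<^sup>2 * (R u)\<^sup>2)"
        using mult_left_mono[OF sq, of "exp M"] by (simp add: mult_ac)
      finally show "(sqrt (f u) - sqrt (g u))\<^sup>2 \<le> exp M * C\<^sup>2 * (R u)\<^sup>2" by (simp add: mult_ac)
    qed (use R2 in auto)
  qed (use Z in \<open>auto intro!: Bochner_Integration.integral_nonneg\<close>)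
  also have "\<dots> = (exp M * C)\<^sup>2 * (\<integral>u. (R u)\<^sup>2 \<partial>\<mu>\<^sub>0)"
    by (simp add: exp_minus divide_inverse power_mult_distrib power2_eq_square[of "exp M"])
  finally have "?H\<^sup>2 \<le> (exp M * C)\<^sup>2 * (\<integral>u. (R u)\<^sup>2 \<partial>\<mu>\<^sub>0)" .
  then have "?H \<le> sqrt ((exp M * C)\<^sup>2 * (\<integral>u. (R u)\<^sup>2 \<partial>\<mu>\<^sub>0))" by (rule real_le_rsqrt)
  also have "\<dots> = exp M * C * L2_norm \<mu>\<^sub>0 R"
    using C_nonneg by (simp add: real_sqrt_mult L2_norm_def)
  finally show ?thesis by (simp add: R_def[abs_def])
qed

text \<open>The square roots of the densities are exponentials of halved potentials, whose distance
  \<open>sq_stable\<close> controls directly; so \<open>exp M\<close> arises only once, from the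
  evidence. Fubini exchanges the integral over \<open>u\<close> with the expectation.\<close>

lemma hellinger_sample_le:
  assumes "q \<ge> 2"
  shows "sqrt (\<integral>\<omega>. (hellinger \<mu>\<^sub>0 (posterior \<mu>\<^sub>0 \<Phi>) (posterior \<mu>\<^sub>0 (\<Psi> \<omega>)))\<^sup>2 \<partial>P)
    \<le> sqrt (exp M * C) * L2_norm \<mu>\<^sub>0 (\<lambda>u. (\<integral>\<omega>. D \<omega> u powr q \<partial>P) powr (1 / q))"
proof -
  define E where "E \<omega> u = (exp (- \<Phi> u / 2) - exp (- \<Psi> \<omega> u / 2))\<^sup>2" for \<omega> u
  define R where "R u = (\<integral>\<omega>. D \<omega> u powr q \<partial>P) powr (1 / q)" for u
  let ?H = "\<lambda>\<omega>. hellinger \<mu>\<^sub>0 (posterior \<mu>\<^sub>0 \<Phi>) (posterior \<mu>\<^sub>0 (\<Psi> \<omega>))"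
  let ?Z = "\<integral>u. exp (- \<Phi> u) \<partial>\<mu>\<^sub>0"
  have R2: "integrable \<mu>\<^sub>0 (\<lambda>u. (R u)\<^sup>2)"
    using Lq_error_integrable[of q] assms by (simp add: R_def)
  have E_le: "(\<integral>\<omega>. E \<omega> u \<partial>P) \<le> C * (R u)\<^sup>2" if u: "u \<in> space \<mu>\<^sub>0" for u
  proof -
    have "D \<omega> u powr 2 = (D \<omega> u)\<^sup>2" for \<omega> using D_nonneg by simp
    then have "(\<integral>\<omega>. (D \<omega> u)\<^sup>2 \<partial>P) \<le> (R u)\<^sup>2"
      using moment_le_Lq_error(2)[of 2 q u] assms u by (simp add: R_def)
    then show ?thesis
      using sq_stable[OF u] mult_left_mono[OF _ C_nonneg] unfolding E_def by (meson order_trans)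
  qed
  have E_int: "integrable P (\<lambda>\<omega>. E \<omega> u)" if u: "u \<in> space \<mu>\<^sub>0" for u
  proof (rule Bochner_Integration.integrable_bound)
    show "integrable P (\<lambda>\<omega>. 2 * exp (- \<Phi> u) + 2 * exp (- \<Psi> \<omega> u))"
      using exp_\<Psi>_integrable[OF u] by auto
    show "(\<lambda>\<omega>. E \<omega> u) \<in> borel_measurable P" using u unfolding E_def by measurable
    have "E \<omega> u \<le> 2 * exp (- \<Phi> u) + 2 * exp (- \<Psi> \<omega> u)" for \<omega>
    proof -
      let ?p = "exp (- \<Phi> u / 2)" and ?r = "exp (- \<Psi> \<omega> u / 2)"
      have "(?p - ?r)\<^sup>2 \<le> 2 * ?p\<^sup>2 + 2 * ?r\<^sup>2"
        using zero_le_power2[of "?p + ?r"] unfolding power2_diff power2_sum by linarith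
      then show ?thesis by (simp add: E_def flip: exp_double)
    qed
    then show "AE \<omega> in P. norm (E \<omega> u) \<le> norm (2 * exp (- \<Phi> u) + 2 * exp (- \<Psi> \<omega> u))"
      by (auto simp: E_def intro!: AE_I2 order_trans[OF _ abs_ge_self])
  qed
  have E_prod: "integrable (\<mu>\<^sub>0 \<Otimes>\<^sub>M P) (\<lambda>(u, \<omega>). E \<omega> u)"
  proof (rule integrable_product[where h="\<lambda>u. C * (R u)\<^sup>2"])
    show "(\<lambda>(u, \<omega>). E \<omega> u) \<in> borel_measurable (\<mu>\<^sub>0 \<Otimes>\<^sub>M P)" unfolding E_def by measurable
  qed (use E_int E_le R2 in \<open>auto simp: E_def\<close>)
  have E_P: "integrable P (\<lambda>\<omega>. \<integral>u. E \<omega> u \<partial>\<mu>\<^sub>0)"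
    using swap.integrable_snd[OF E_prod] .
  \<comment> \<open>Only almost every path has an integrable density. On the other paths the
    normalising integral takes the default value \<open>0\<close>, which a null set hides.\<close>
  have "AE \<omega> in P. integrable \<mu>\<^sub>0 (\<lambda>u. exp (- \<Psi> \<omega> u))"
    using swap.AE_integrable_snd[OF exp_\<Psi>_product] .
  then have H_le: "AE \<omega> in P. (?H \<omega>)\<^sup>2 \<le> exp M * (\<integral>u. E \<omega> u \<partial>\<mu>\<^sub>0)"
  proof eventually_elim
    case (elim \<omega>)
    have W: "0 < (\<integral>u. exp (- \<Psi> \<omega> u) \<partial>\<mu>\<^sub>0)"
      using elim by (intro prior.expectation_greater) auto
    have "(?H \<omega>)\<^sup>2 \<le> (\<integral>u. (sqrt (exp (- \<Phi> u)) - sqrt (exp (- \<Psi> \<omega> u)))\<^sup>2 \<partial>\<mu>\<^sub>0) / ?Z"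
      unfolding posterior_def
      by (intro prior.hellinger_density_sq_le exp_\<Phi>_integrable elim evidence_pos W) auto
    also have "\<dots> = (\<integral>u. E \<omega> u \<partial>\<mu>\<^sub>0) / ?Z" by (simp add: sqrt_exp E_def)
    also have "\<dots> \<le> (\<integral>u. E \<omega> u \<partial>\<mu>\<^sub>0) / exp (- M)"
      using evidence_ge by (intro divide_left_mono mult_pos_pos evidence_pos)
        (auto simp: E_def intro!: Bochner_Integration.integral_nonneg)
    finally show ?case by (simp add: exp_minus field_simps)
  qed
  \<comment> \<open>The comparison rests on integrability of the upper bound: were the left
    integrand not integrable, its integral would be \<open>0\<close>, and the bound is
    nonnegative.\<close>
  have "(\<integral>\<omega>. (?H \<omega>)\<^sup>2 \<partial>P) \<le> (\<integral>\<omega>. exp M * (\<integral>u. E \<omega> u \<partial>\<mu>\<^sub>0) \<partial>P)"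
    using E_P H_le by (intro integral_mono_AE') (auto simp: E_def intro!: Bochner_Integration.integral_nonneg)
  also have "\<dots> = exp M * (\<integral>u. (\<integral>\<omega>. E \<omega> u \<partial>P) \<partial>\<mu>\<^sub>0)"
    using swap.Fubini_integral[OF E_prod] by simp
  also have "\<dots> \<le> exp M * (\<integral>u. C * (R u)\<^sup>2 \<partial>\<mu>\<^sub>0)"
    using E_le R2 C_nonneg by (intro mult_left_mono integral_mono') auto
  also have "\<dots> = exp M * C * (\<integral>u. (R u)\<^sup>2 \<partial>\<mu>\<^sub>0)" by simp
  finally have "sqrt (\<integral>\<omega>. (?H \<omega>)\<^sup>2 \<partial>P) \<le> sqrt (exp M * C * (\<integral>u. (R u)\<^sup>2 \<partial>\<mu>\<^sub>0))" by simp
  also have "\<dots> = sqrt (exp M * C) * L2_norm \<mu>\<^sub>0 R" by (simp add: real_sqrt_mult L2_norm_def)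
  finally show ?thesis by (simp add: R_def[abs_def])
qed

end

section \<open>Stability of the misfit\<close>

text \<open>Writing \<open>x\<close> as \<open>\<Gamma> *v z\<close> turns the form of the inverse
  matrix into the form of \<open>\<Gamma>\<close> itself.\<close>

lemma weighted_sqnorm_nonneg:
  assumes "pos_def_matrix \<Gamma>"
  shows "0 \<le> weighted_sqnorm \<Gamma> x"
proof -
  have pos: "inner z (\<Gamma> *v z) > 0" if "z \<noteq> 0" for z
    using assms that by (auto simp: pos_def_matrix_def)
  have "\<forall>z. \<Gamma> *v z = 0 \<longrightarrow> z = 0"
    using pos by (metis inner_zero_right less_irrefl)
  then have "invertible \<Gamma>" by (simp add: invertible_left_inverse matrix_left_invertible_ker)
  then have inv: "\<Gamma> ** matrix_inv \<Gamma> = Finite_Cartesian_Product.mat 1"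
    unfolding invertible_def matrix_inv_def by (rule someI2_ex) auto
  define z where "z = matrix_inv \<Gamma> *v x"
  have "\<Gamma> *v z = x" by (simp add: z_def matrix_vector_mul_assoc inv)
  then have "weighted_sqnorm \<Gamma> x = inner z (\<Gamma> *v z)"
    by (simp add: weighted_sqnorm_def z_def inner_commute)
  then show ?thesis using pos[of z] by (cases "z = 0") auto
qed

lemma weighted_sqnorm_measurable[measurable]: "weighted_sqnorm \<Gamma> \<in> borel_measurable borel"
  unfolding weighted_sqnorm_def[abs_def]
  by (intro borel_measurable_continuous_onI continuous_on_inner continuous_on_id
    linear_continuous_on matrix_vector_mul_bounded_linear)

text \<open>Expansion of the quadratic form, with an operator bound \<open>L\<close> of the inverse
  matrix in each of the three terms. The quadratic growth in \<open>h\<close> is tamed only after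
  exponentiation.\<close>

lemma weighted_sqnorm_diff_le:
  "\<exists>L\<ge>0. \<forall>v h. \<bar>weighted_sqnorm \<Gamma> (v + h) - weighted_sqnorm \<Gamma> v\<bar>
    \<le> L * (2 * norm v + norm h) * norm h"
proof -
  let ?A = "(*v) (matrix_inv \<Gamma>)"
  obtain L where L: "L \<ge> 0" "\<And>x. norm (?A x) \<le> norm x * L"
    using bounded_linear.nonneg_bounded[OF matrix_vector_mul_bounded_linear[of "matrix_inv \<Gamma>"]] by auto
  have ip: "\<bar>inner x (?A z)\<bar> \<le> L * (norm x * norm z)" for x z
  proof -
    have "\<bar>inner x (?A z)\<bar> \<le> norm x * norm (?A z)" by (rule Cauchy_Schwarz_ineq2)
    also have "\<dots> \<le> norm x * (norm z * L)" using L by (intro mult_left_mono) auto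
    finally show ?thesis by (simp add: mult_ac)
  qed
  have "\<bar>weighted_sqnorm \<Gamma> (v + h) - weighted_sqnorm \<Gamma> v\<bar> \<le> L * (2 * norm v + norm h) * norm h" for v h
  proof -
    have "weighted_sqnorm \<Gamma> (v + h) - weighted_sqnorm \<Gamma> v = inner v (?A h) + inner h (?A v) + inner h (?A h)"
      by (simp add: weighted_sqnorm_def matrix_vector_right_distrib inner_add_left inner_add_right)
    also have "\<bar>\<dots>\<bar> \<le> L * (norm v * norm h) + L * (norm h * norm v) + L * (norm h * norm h)"
      using ip[of v h] ip[of h v] ip[of h h] by linarith
    finally show ?thesis by (simp add: algebra_simps)
  qed
  then show ?thesis using L(1) by blast
qed

text \<open>Supplies the upper bound on the potential that keeps the evidence away from
  zero.\<close>

lemma misfit_bounded: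
  fixes \<Gamma> :: "real ^ 'n ^ 'n" and y :: "real ^ 'n" and G :: "'c \<Rightarrow> real ^ 'n"
  assumes "pos_def_matrix \<Gamma>"
  shows "\<exists>M. \<forall>u. norm (G u) \<le> CG \<longrightarrow> misfit \<Gamma> y G u \<le> M"
proof -
  obtain L where L: "L \<ge> 0"
    "\<And>v h. \<bar>weighted_sqnorm \<Gamma> (v + h) - weighted_sqnorm \<Gamma> v\<bar> \<le> L * (2 * norm v + norm h) * norm h"
    using weighted_sqnorm_diff_le[of \<Gamma>] by blast
  have "misfit \<Gamma> y G u \<le> 1 / 2 * (L * (norm y + CG) * (norm y + CG))" if "norm (G u) \<le> CG" for u
  proof -
    have n: "norm (y - G u) \<le> norm y + CG" using that norm_triangle_ineq4[of y "G u"] by linarith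
    have "weighted_sqnorm \<Gamma> (y - G u) \<le> L * norm (y - G u) * norm (y - G u)"
      \<comment> \<open>Expansion around \<open>0\<close>, where the form vanishes.\<close>
      using L(2)[of 0 "y - G u"] by (simp add: weighted_sqnorm_def)
    also have "\<dots> \<le> L * (norm y + CG) * (norm y + CG)"
      using n L norm_ge_zero[of "y - G u"] by (intro mult_mono mult_nonneg_nonneg) linarith+
    finally show ?thesis by (simp add: misfit_def)
  qed
  then show ?thesis by blast
qed

text \<open>For \<open>h \<le> 1\<close> both \<open>1 + h\<close> and the sum of the exponentials
  are at most two, which gives \<open>4 * c\<close>. For \<open>h > 1\<close> the left-hand side is
  at most one, hence below \<open>h\<close>.\<close>

lemma abs_exp_minus_diff_le_linear:
  fixes a b c h :: real
  assumes "0 \<le> a" "0 \<le> b" "0 \<le> c" "0 \<le> h" "\<bar>a - b\<bar> \<le> c * (1 + h) * h"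
  shows "\<bar>exp (- a) - exp (- b)\<bar> \<le> (1 + 4 * c) * h"
proof (cases "h \<le> 1")
  case True
  have "\<bar>exp (- a) - exp (- b)\<bar> \<le> (exp (- a) + exp (- b)) * \<bar>a - b\<bar>" by (rule abs_exp_minus_diff_le)
  also have "\<dots> \<le> 2 * \<bar>a - b\<bar>"
  proof (rule mult_right_mono)
    have "exp (- a) \<le> 1" "exp (- b) \<le> 1" using assms by auto
    then show "exp (- a) + exp (- b) \<le> 2" by linarith
  qed simp
  also have "\<bar>a - b\<bar> \<le> c * 2 * h"
    using assms True by (intro order_trans[OF assms(5)] mult_right_mono mult_left_mono) auto
  finally show ?thesis using assms by (simp add: algebra_simps)
next
  case False
  have "\<bar>exp (- a) - exp (- b)\<bar> \<le> 1"
  proof -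
    have "exp (- a) \<le> 1" "exp (- b) \<le> 1" using assms by auto
    then show ?thesis using exp_gt_zero[of "- a"] exp_gt_zero[of "- b"] by linarith
  qed
  also have "1 \<le> 1 * h" using False by simp
  also have "\<dots> \<le> (1 + 4 * c) * h" using assms by (intro mult_right_mono) auto
  finally show ?thesis .
qed

text \<open>One constant serves every \<open>H\<close>, hence all realisations of all emulators.
  Halved potentials satisfy the same quadratic estimate, so the constant covers them too.\<close>

lemma exp_misfit_Lipschitz:
  fixes \<Gamma> :: "real ^ 'n ^ 'n" and y :: "real ^ 'n" and G :: "'c \<Rightarrow> real ^ 'n"
  assumes "pos_def_matrix \<Gamma>"
  shows "\<exists>L\<ge>0. \<forall>H u. norm (G u) \<le> CG \<longrightarrow>
    \<bar>exp (- misfit \<Gamma> y G u) - exp (- misfit \<Gamma> y H u)\<bar> \<le> L * norm (G u - H u) \<and>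
    \<bar>exp (- misfit \<Gamma> y G u / 2) - exp (- misfit \<Gamma> y H u / 2)\<bar> \<le> L * norm (G u - H u)"
proof -
  obtain L where L: "L \<ge> 0"
    "\<And>v h. \<bar>weighted_sqnorm \<Gamma> (v + h) - weighted_sqnorm \<Gamma> v\<bar> \<le> L * (2 * norm v + norm h) * norm h"
    using weighted_sqnorm_diff_le[of \<Gamma>] by blast
  \<comment> \<open>The absolute value keeps \<open>c\<close> nonnegative for every real
    \<open>CG\<close>.\<close>
  define c where "c = L * (norm y + \<bar>CG\<bar> + 1)"
  have c: "c \<ge> 0" using L by (simp add: c_def)
  have nonneg: "0 \<le> misfit \<Gamma> y H u" for H :: "'c \<Rightarrow> real ^ 'n" and u
    using weighted_sqnorm_nonneg[OF assms] by (simp add: misfit_def)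
  have diff: "\<bar>misfit \<Gamma> y G u - misfit \<Gamma> y H u\<bar> \<le> c * (1 + norm (G u - H u)) * norm (G u - H u)"
    if "norm (G u) \<le> CG" for H :: "'c \<Rightarrow> real ^ 'n" and u
  proof -
    let ?h = "norm (G u - H u)"
    have n: "norm (y - G u) \<le> norm y + \<bar>CG\<bar>" using that norm_triangle_ineq4[of y "G u"] by linarith
    have "\<bar>misfit \<Gamma> y G u - misfit \<Gamma> y H u\<bar> = 1 / 2 * \<bar>weighted_sqnorm \<Gamma> ((y - G u) + (G u - H u)) - weighted_sqnorm \<Gamma> (y - G u)\<bar>"
      by (simp add: misfit_def abs_if)
    also have "\<dots> \<le> 1 / 2 * (L * (2 * norm (y - G u) + ?h) * ?h)"
      by (intro mult_left_mono L(2)) simp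
    also have "\<dots> = L * (norm (y - G u) + ?h / 2) * ?h" by (simp add: algebra_simps)
    also have "\<dots> \<le> L * ((norm y + \<bar>CG\<bar> + 1) * (1 + ?h)) * ?h"
    proof (intro mult_right_mono mult_left_mono)
      have "norm (y - G u) + ?h / 2 \<le> (norm y + \<bar>CG\<bar> + 1) * 1 + 1 * ?h"
        by (rule order_trans[OF add_mono[OF n, of "?h / 2" ?h]]) simp_all
      also have "\<dots> \<le> (norm y + \<bar>CG\<bar> + 1) * 1 + (norm y + \<bar>CG\<bar> + 1) * ?h"
        by (intro add_left_mono mult_right_mono) auto
      finally show "norm (y - G u) + ?h / 2 \<le> (norm y + \<bar>CG\<bar> + 1) * (1 + ?h)" by (simp only: distrib_left)
    qed (use L in auto)
    finally show ?thesis by (simp add: c_def mult.assoc)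
  qed
  show ?thesis
  proof (intro exI[of _ "1 + 4 * c"] conjI allI impI)
    show "1 + 4 * c \<ge> 0" using c by simp
    fix H :: "'c \<Rightarrow> real ^ 'n" and u assume G: "norm (G u) \<le> CG"
    show "\<bar>exp (- misfit \<Gamma> y G u) - exp (- misfit \<Gamma> y H u)\<bar> \<le> (1 + 4 * c) * norm (G u - H u)"
      using diff[of u H, OF G] nonneg c by (intro abs_exp_minus_diff_le_linear) auto
    have "\<bar>misfit \<Gamma> y G u / 2 - misfit \<Gamma> y H u / 2\<bar> \<le> c * (1 + norm (G u - H u)) * norm (G u - H u)"
      using diff[of u H, OF G] by (simp add: abs_if split: if_splits)
    then show "\<bar>exp (- misfit \<Gamma> y G u / 2) - exp (- misfit \<Gamma> y H u / 2)\<bar> \<le> (1 + 4 * c) * norm (G u - H u)"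
      using abs_exp_minus_diff_le_linear[of "misfit \<Gamma> y G u / 2" "misfit \<Gamma> y H u / 2" c "norm (G u - H u)"] nonneg c
      by simp
  qed
qed

text \<open>The largest component dominates the norm up to the dimension, an argument valid for all
  \<open>q > 0\<close>. It reduces moments of the vector error to scalar normal moments.\<close>

lemma norm_powr_le_sum:
  fixes x :: "real ^ 'n"
  assumes "q > 0"
  shows "norm x powr q \<le> (\<Sum>j\<in>UNIV. real CARD('n) powr q * \<bar>x $ j\<bar> powr q)"
proof -
  define m where "m = Max (range (\<lambda>j. \<bar>x $ j\<bar>))"
  have "m \<in> range (\<lambda>j. \<bar>x $ j\<bar>)" unfolding m_def by (intro Max_in) auto
  then obtain j where j: "m = \<bar>x $ j\<bar>" by auto
  have "\<bar>x $ i\<bar> \<le> m" for i unfolding m_def by (intro Max_ge) auto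
  then have "norm x \<le> real CARD('n) * m"
    using norm_le_l1_cart[of x] sum_bounded_above[of UNIV "\<lambda>i. \<bar>x $ i\<bar>" m] by fastforce
  then have "norm x powr q \<le> (real CARD('n) * \<bar>x $ j\<bar>) powr q"
    using assms unfolding j by (intro powr_mono2) auto
  also have "\<dots> = real CARD('n) powr q * \<bar>x $ j\<bar> powr q" by (simp add: powr_mult)
  also have "\<dots> \<le> (\<Sum>j\<in>UNIV. real CARD('n) powr q * \<bar>x $ j\<bar> powr q)"
    by (rule member_le_sum) auto
  finally show ?thesis .
qed

text \<open>The linear combination consisting of a single point with weight one.\<close>

lemma gaussian_process_normal_rv:
  assumes "gaussian_process P U X m k" "u \<in> U"
  shows "normal_rv P (\<lambda>\<omega>. X \<omega> u) (m u) (k u u)"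
proof -
  have "\<forall>F c. finite F \<and> F \<subseteq> U \<longrightarrow> normal_rv P (\<lambda>\<omega>. \<Sum>u\<in>F. c u * X \<omega> u)
      (\<Sum>u\<in>F. c u * m u) (\<Sum>u\<in>F. \<Sum>v\<in>F. c u * c v * k u v)"
    using assms by (simp add: gaussian_process_def)
  from this[rule_format, of "{u}" "\<lambda>_. 1"] show ?thesis using assms by simp
qed

theorem theorem5p2:
  fixes U :: "(real ^ 'du) set"
    and \<mu>\<^sub>0 :: "(real ^ 'du) measure"
    and \<Gamma> :: "real ^ 'dy ^ 'dy"
    and y :: "real ^ 'dy"
    and G :: "real ^ 'du \<Rightarrow> real ^ 'dy"
    and R S :: "(real ^ 'dt) set"
    and m :: "real ^ 'dt \<Rightarrow> real ^ 'du \<Rightarrow> real"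
    and k :: "real ^ 'dt \<Rightarrow> real ^ 'du \<Rightarrow> real ^ 'du \<Rightarrow> real"
    and D :: "nat \<Rightarrow> (real ^ 'du) list"
    and \<theta> :: "nat \<Rightarrow> real ^ 'dt"
    and PG :: "nat \<Rightarrow> 'a measure"
    and GN :: "nat \<Rightarrow> 'a \<Rightarrow> real ^ 'du \<Rightarrow> real ^ 'dy"
    and P\<Phi> :: "nat \<Rightarrow> 'b measure"
    and \<Phi>N :: "nat \<Rightarrow> 'b \<Rightarrow> real ^ 'du \<Rightarrow> real"
    and CG :: real
  assumes prior: "prob_space \<mu>\<^sub>0" "sets \<mu>\<^sub>0 = sets (restrict_space borel U)"
    and noise: "pos_def_matrix \<Gamma>"
    and G_meas: "G \<in> borel_measurable \<mu>\<^sub>0"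
    and m_meas: "\<And>t. t \<in> R \<Longrightarrow> m t \<in> borel_measurable \<mu>\<^sub>0"
    and k_meas: "\<And>t. t \<in> R \<Longrightarrow> (\<lambda>(u, v). k t u v) \<in> borel_measurable (\<mu>\<^sub>0 \<Otimes>\<^sub>M \<mu>\<^sub>0)"
    and k_pos_def: "\<And>t. t \<in> R \<Longrightarrow> pos_def_kernel U (k t)"
    and design: "\<And>N. N \<ge> 1 \<Longrightarrow> length (D N) = N \<and> distinct (D N) \<and> set (D N) \<subseteq> U"
    and hyper: "compact S" "S \<subseteq> R" "\<And>N. N \<ge> 1 \<Longrightarrow> \<theta> N \<in> S"
    and GN_process: "\<And>N j. N \<ge> 1 \<Longrightarrow> gaussian_process (PG N) U (\<lambda>\<omega> u. GN N \<omega> u $ j)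
          (pred_mean (m (\<theta> N)) (k (\<theta> N)) (D N) (\<lambda>u. G u $ j)) (pred_cov (k (\<theta> N)) (D N))"
    and GN_indep: "\<And>N. N \<ge> 1 \<Longrightarrow> indep_components (PG N) U (GN N)"
    and GN_version: "\<And>N. N \<ge> 1 \<Longrightarrow> measurable_process (PG N) \<mu>\<^sub>0 (GN N)"
          "\<And>N. N \<ge> 1 \<Longrightarrow> separable_process (PG N) U (GN N)"
    and \<Phi>N_process: "\<And>N. N \<ge> 1 \<Longrightarrow> gaussian_process (P\<Phi> N) U (\<Phi>N N)
          (pred_mean (m (\<theta> N)) (k (\<theta> N)) (D N) (misfit \<Gamma> y G)) (pred_cov (k (\<theta> N)) (D N))"
    and \<Phi>N_version: "\<And>N. N \<ge> 1 \<Longrightarrow> measurable_process (P\<Phi> N) \<mu>\<^sub>0 (\<Phi>N N)"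
          "\<And>N. N \<ge> 1 \<Longrightarrow> separable_process (P\<Phi> N) U (\<Phi>N N)"
    and a: "bounded U"
    and b_G: "\<exists>B. \<forall>N\<ge>1. \<forall>u\<in>U.
          norm (G u - pred_mean_vec (m (\<theta> N)) (k (\<theta> N)) (D N) G u) \<le> B"
    and b_\<Phi>: "\<exists>B. \<forall>N\<ge>1. \<forall>u\<in>U.
          \<bar>misfit \<Gamma> y G u - pred_mean (m (\<theta> N)) (k (\<theta> N)) (D N) (misfit \<Gamma> y G) u\<bar> \<le> B"
    and b_k: "\<And>N. N \<ge> 1 \<Longrightarrow> bdd_above ((\<lambda>u. pred_cov (k (\<theta> N)) (D N) u u) ` U)"
          "(\<lambda>N. SUP u\<in>U. pred_cov (k (\<theta> N)) (D N) u u) \<longlonglongrightarrow> 0"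
    and c: "\<And>u. u \<in> U \<Longrightarrow> norm (G u) \<le> CG"
    and d_\<Phi>: "\<exists>B. \<forall>N\<ge>1. expected_sup_le (P\<Phi> N) U
          (\<lambda>\<omega> u. \<Phi>N N \<omega> u - pred_mean (m (\<theta> N)) (k (\<theta> N)) (D N) (misfit \<Gamma> y G) u) B"
    and d_G: "\<And>j. \<exists>B. \<forall>N\<ge>1. expected_sup_le (PG N) U
          (\<lambda>\<omega> u. GN N \<omega> u $ j - pred_mean (m (\<theta> N)) (k (\<theta> N)) (D N) (\<lambda>v. G v $ j) u) B"
  shows "\<exists>C1 C2 C3 C4 :: real. \<forall>\<delta>>0. \<forall>N\<ge>1.
      hellinger \<mu>\<^sub>0 (posterior \<mu>\<^sub>0 (misfit \<Gamma> y G))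
          (marginal_posterior (PG N) \<mu>\<^sub>0 (\<lambda>\<omega>. misfit \<Gamma> y (GN N \<omega>)))
        \<le> C1 * L2_norm \<mu>\<^sub>0 (\<lambda>u.
            (\<integral>\<omega>. norm (G u - GN N \<omega> u) powr (1 + \<delta>) \<partial>PG N) powr (1 / (1 + \<delta>)))
    \<and> hellinger \<mu>\<^sub>0 (posterior \<mu>\<^sub>0 (misfit \<Gamma> y G))
          (marginal_posterior (P\<Phi> N) \<mu>\<^sub>0 (\<Phi>N N))
        \<le> C2 * L2_norm \<mu>\<^sub>0 (\<lambda>u.
            (\<integral>\<omega>. \<bar>misfit \<Gamma> y G u - \<Phi>N N \<omega> u\<bar> powr (1 + \<delta>) \<partial>P\<Phi> N) powr (1 / (1 + \<delta>)))
    \<and> sqrt (\<integral>\<omega>. (hellinger \<mu>\<^sub>0 (posterior \<mu>\<^sub>0 (misfit \<Gamma> y G))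
          (posterior \<mu>\<^sub>0 (misfit \<Gamma> y (GN N \<omega>))))\<^sup>2 \<partial>PG N)
        \<le> C3 * L2_norm \<mu>\<^sub>0 (\<lambda>u.
            (\<integral>\<omega>. norm (G u - GN N \<omega> u) powr (2 + \<delta>) \<partial>PG N) powr (1 / (2 + \<delta>)))
    \<and> sqrt (\<integral>\<omega>. (hellinger \<mu>\<^sub>0 (posterior \<mu>\<^sub>0 (misfit \<Gamma> y G))
          (posterior \<mu>\<^sub>0 (\<Phi>N N \<omega>)))\<^sup>2 \<partial>P\<Phi> N)
        \<le> C4 * L2_norm \<mu>\<^sub>0 (\<lambda>u.
            (\<integral>\<omega>. \<bar>misfit \<Gamma> y G u - \<Phi>N N \<omega> u\<bar> powr (2 + \<delta>) \<partial>P\<Phi> N) powr (1 / (2 + \<delta>)))"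
proof -

  \<comment> \<open>Bounds uniform in \<open>N\<close>\<close>
  note integrable_const_bound = finite_measure.integrable_const_bound[OF prob_space.finite_measure]
  have space: "space \<mu>\<^sub>0 = U"
    using sets_eq_imp_space_eq[OF prior(2)] by (simp add: space_restrict_space)
  let ?\<Phi> = "misfit \<Gamma> y G"
  let ?k = "\<lambda>N. pred_cov (k (\<theta> N)) (D N)"
  let ?mG = "\<lambda>N j. pred_mean (m (\<theta> N)) (k (\<theta> N)) (D N) (\<lambda>u. G u $ j)"
  let ?m\<Phi> = "\<lambda>N. pred_mean (m (\<theta> N)) (k (\<theta> N)) (D N) ?\<Phi>"
  obtain K where K: "\<And>N u. N \<ge> 1 \<Longrightarrow> u \<in> U \<Longrightarrow> ?k N u u \<le> K"
  proof -
    \<comment> \<open>A convergent sequence is bounded, and \<open>bdd_above\<close> turns a bound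
      on the supremum into one on every predictive variance.\<close>
    obtain K where K: "\<And>N. norm (SUP u\<in>U. ?k N u u) \<le> K"
      using convergent_imp_Bseq[OF convergentI[OF b_k(2)]] by (auto simp: Bseq_def)
    then have "?k N u u \<le> K" if "N \<ge> 1" "u \<in> U" for N u
      using order_trans[OF cSUP_upper[OF that(2) b_k(1)[OF that(1)]] abs_le_D1[OF K[unfolded real_norm_def]]] by simp
    then show thesis using that by blast
  qed
  obtain BG where BG: "\<And>N u. N \<ge> 1 \<Longrightarrow> u \<in> U \<Longrightarrow>
      norm (G u - pred_mean_vec (m (\<theta> N)) (k (\<theta> N)) (D N) G u) \<le> BG"
    using b_G by blast
  obtain B\<Phi> where B\<Phi>: "\<And>N u. N \<ge> 1 \<Longrightarrow> u \<in> U \<Longrightarrow> \<bar>?\<Phi> u - ?m\<Phi> N u\<bar> \<le> B\<Phi>"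
    using b_\<Phi> by blast
  obtain M where M: "\<And>u. norm (G u) \<le> CG \<Longrightarrow> ?\<Phi> u \<le> M"
    using misfit_bounded[OF noise, of G CG y] by blast
  obtain L where L: "L \<ge> 0"
    "\<And>H u. norm (G u) \<le> CG \<Longrightarrow> \<bar>exp (- ?\<Phi> u) - exp (- misfit \<Gamma> y H u)\<bar> \<le> L * norm (G u - H u)"
    "\<And>H u. norm (G u) \<le> CG \<Longrightarrow> \<bar>exp (- ?\<Phi> u / 2) - exp (- misfit \<Gamma> y H u / 2)\<bar> \<le> L * norm (G u - H u)"
    using exp_misfit_Lipschitz[OF noise, of G CG y] by blast
  have \<Phi>0: "0 \<le> misfit \<Gamma> y H u" for H :: "real ^ 'du \<Rightarrow> _" and u
    using weighted_sqnorm_nonneg[OF noise] by (simp add: misfit_def)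
  have misfit_borel[measurable]: "(\<lambda>x. 1 / 2 * weighted_sqnorm \<Gamma> (y - x)) \<in> borel_measurable borel"
    by measurable
  have \<Phi>_meas[measurable]: "?\<Phi> \<in> borel_measurable \<mu>\<^sub>0"
    unfolding misfit_def[abs_def] using G_meas by measurable
  have exp_\<Phi>: "integrable \<mu>\<^sub>0 (\<lambda>u. exp (- ?\<Phi> u))"
    using \<Phi>0 by (intro integrable_const_bound[OF prior(1), of _ 1]) auto

  \<comment> \<open>The emulated forward map\<close>
  have RG: "random_potential \<mu>\<^sub>0 (PG N) ?\<Phi> (\<lambda>\<omega>. misfit \<Gamma> y (GN N \<omega>)) (\<lambda>\<omega> u. norm (G u - GN N \<omega> u)) M 1 (L + L\<^sup>2)"
    if N: "N \<ge> 1" for N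
  proof -
    have P: "prob_space (PG N)"
      using GN_process[OF N] by (auto simp: gaussian_process_def)
    have proc[measurable]: "(\<lambda>p. GN N (fst p) (snd p)) \<in> borel_measurable (PG N \<Otimes>\<^sub>M \<mu>\<^sub>0)"
      using GN_version(1)[OF N] by (simp add: measurable_process_def case_prod_beta')
    have sec[measurable]: "(\<lambda>\<omega>. GN N \<omega> u) \<in> borel_measurable (PG N)" if "u \<in> U" for u
      using measurable_compose[OF measurable_Pair2' proc] space that by simp
    have nrv: "normal_rv (PG N) (\<lambda>\<omega>. GN N \<omega> u $ j) (?mG N j u) (?k N u u)" if "u \<in> U" for u j
      by (rule gaussian_process_normal_rv[OF GN_process[OF N] that])
    have mean: "\<bar>G u $ j - ?mG N j u\<bar> \<le> BG" if "u \<in> U" for u j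
      using component_le_norm_cart[of "G u - pred_mean_vec (m (\<theta> N)) (k (\<theta> N)) (D N) G u" j] BG[OF N that]
      by (simp add: pred_mean_vec_def)
    \<comment> \<open>The components are normal with bias at most \<open>BG\<close> and variance at
      most \<open>K\<close>, so their powers have moments bounded uniformly in
      \<open>u\<close>.\<close>
    have pw: "integrable (PG N) (\<lambda>\<omega>. norm (G u - GN N \<omega> u) powr q) \<and>
        (\<integral>\<omega>. norm (G u - GN N \<omega> u) powr q \<partial>PG N)
          \<le> (\<Sum>j\<in>(UNIV :: 'dy set). real CARD('dy) powr q * (q powr q * (2 * exp (BG + K / 2))))"
      if u: "u \<in> U" and q: "q > 0" for u q
    proof -
      let ?S = "\<lambda>\<omega>. \<Sum>j\<in>UNIV. real CARD('dy) powr q * \<bar>G u $ j - GN N \<omega> u $ j\<bar> powr q"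
      note mom = prob_space.normal_rv_powr_integrable[OF P nrv[OF u] K[OF N u] mean[OF u] q]
        prob_space.normal_rv_powr_le[OF P nrv[OF u] K[OF N u] mean[OF u] q]
      have iS: "integrable (PG N) ?S" using mom(1) by auto
      have le: "norm (G u - GN N \<omega> u) powr q \<le> ?S \<omega>" for \<omega>
        using norm_powr_le_sum[OF q, of "G u - GN N \<omega> u"] by simp
      have i: "integrable (PG N) (\<lambda>\<omega>. norm (G u - GN N \<omega> u) powr q)"
        by (rule Bochner_Integration.integrable_bound[OF iS])
          (use le u in \<open>auto intro!: AE_I2 order_trans[OF le abs_ge_self]\<close>)
      have "(\<integral>\<omega>. norm (G u - GN N \<omega> u) powr q \<partial>PG N) \<le> (\<integral>\<omega>. ?S \<omega> \<partial>PG N)"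
        using i iS le by (intro integral_mono) auto
      also have "\<dots> = (\<Sum>j\<in>UNIV. real CARD('dy) powr q * (\<integral>\<omega>. \<bar>G u $ j - GN N \<omega> u $ j\<bar> powr q \<partial>PG N))"
        using mom(1) by simp
      also have "\<dots> \<le> (\<Sum>j\<in>(UNIV :: 'dy set). real CARD('dy) powr q * (q powr q * (2 * exp (BG + K / 2))))"
        using mom(2) by (intro sum_mono mult_left_mono) auto
      finally show ?thesis using i by simp
    qed
    show ?thesis
    proof (rule random_potential.intro[OF prior(1) P random_potential_axioms.intro])
      show "(\<lambda>(\<omega>, u). misfit \<Gamma> y (GN N \<omega>) u) \<in> borel_measurable (PG N \<Otimes>\<^sub>M \<mu>\<^sub>0)"
        using measurable_compose[OF proc misfit_borel] by (simp add: misfit_def case_prod_beta')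
      show "(\<lambda>(\<omega>, u). norm (G u - GN N \<omega> u)) \<in> borel_measurable (PG N \<Otimes>\<^sub>M \<mu>\<^sub>0)"
        unfolding case_prod_beta' using G_meas by measurable
      fix u assume "u \<in> space \<mu>\<^sub>0"
      then have u: "u \<in> U" by (simp add: space)
      have m: "(\<lambda>\<omega>. misfit \<Gamma> y (GN N \<omega>) u) \<in> borel_measurable (PG N)"
        using measurable_compose[OF sec[OF u] misfit_borel] by (simp add: misfit_def)
      show iE: "integrable (PG N) (\<lambda>\<omega>. exp (- misfit \<Gamma> y (GN N \<omega>) u))"
        using m \<Phi>0 by (intro integrable_const_bound[OF P, of _ 1]) auto
      show "(\<integral>\<omega>. exp (- misfit \<Gamma> y (GN N \<omega>) u) \<partial>PG N) \<le> 1"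
        using \<Phi>0 iE by (intro prob_space.integral_le_const[OF P]) auto
      have i1: "integrable (PG N) (\<lambda>\<omega>. norm (G u - GN N \<omega> u))" using pw[OF u, of 1] by simp
      have i2: "integrable (PG N) (\<lambda>\<omega>. (norm (G u - GN N \<omega> u))\<^sup>2)" using pw[OF u, of 2] by simp
      have "exp (- ?\<Phi> u) - (\<integral>\<omega>. exp (- misfit \<Gamma> y (GN N \<omega>) u) \<partial>PG N)
          = (\<integral>\<omega>. exp (- ?\<Phi> u) - exp (- misfit \<Gamma> y (GN N \<omega>) u) \<partial>PG N)"
        using iE by (simp add: prob_space.prob_space[OF P] finite_measure.integrable_const[OF prob_space.finite_measure[OF P]])
      also have "\<bar>\<dots>\<bar> \<le> (\<integral>\<omega>. \<bar>exp (- ?\<Phi> u) - exp (- misfit \<Gamma> y (GN N \<omega>) u)\<bar> \<partial>PG N)"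
        by (rule integral_abs_bound)
      \<comment> \<open>The locale has one constant for both estimates: \<open>L + L\<^sup>2\<close>
        dominates \<open>L\<close>, needed for the mean, and \<open>L\<^sup>2\<close>, needed for
        the mean square.\<close>
      also have "\<dots> \<le> (\<integral>\<omega>. (L + L\<^sup>2) * norm (G u - GN N \<omega> u) \<partial>PG N)"
      proof (rule integral_mono')
        fix \<omega>
        show "\<bar>exp (- ?\<Phi> u) - exp (- misfit \<Gamma> y (GN N \<omega>) u)\<bar> \<le> (L + L\<^sup>2) * norm (G u - GN N \<omega> u)"
          using L(2)[OF c[OF u], of "GN N \<omega>"] mult_right_mono[of L "L + L\<^sup>2" "norm (G u - GN N \<omega> u)"] by simp
      qed (use i1 L in auto)
      finally show "\<bar>exp (- ?\<Phi> u) - (\<integral>\<omega>. exp (- misfit \<Gamma> y (GN N \<omega>) u) \<partial>PG N)\<bar>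
          \<le> (L + L\<^sup>2) * (\<integral>\<omega>. norm (G u - GN N \<omega> u) \<partial>PG N)" by simp
      have "(\<integral>\<omega>. (exp (- ?\<Phi> u / 2) - exp (- misfit \<Gamma> y (GN N \<omega>) u / 2))\<^sup>2 \<partial>PG N)
          \<le> (\<integral>\<omega>. (L + L\<^sup>2) * (norm (G u - GN N \<omega> u))\<^sup>2 \<partial>PG N)"
      proof (rule integral_mono')
        fix \<omega>
        have "\<bar>exp (- ?\<Phi> u / 2) - exp (- misfit \<Gamma> y (GN N \<omega>) u / 2)\<bar>\<^sup>2 \<le> (L * norm (G u - GN N \<omega> u))\<^sup>2"
          by (intro power_mono L(3)[OF c[OF u]]) simp
        also have "\<dots> \<le> (L + L\<^sup>2) * (norm (G u - GN N \<omega> u))\<^sup>2"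
          unfolding power_mult_distrib using L by (intro mult_right_mono) auto
        finally show "(exp (- ?\<Phi> u / 2) - exp (- misfit \<Gamma> y (GN N \<omega>) u / 2))\<^sup>2
            \<le> (L + L\<^sup>2) * (norm (G u - GN N \<omega> u))\<^sup>2" by simp
      qed (use i2 L in auto)
      then show "(\<integral>\<omega>. (exp (- ?\<Phi> u / 2) - exp (- misfit \<Gamma> y (GN N \<omega>) u / 2))\<^sup>2 \<partial>PG N)
          \<le> (L + L\<^sup>2) * (\<integral>\<omega>. (norm (G u - GN N \<omega> u))\<^sup>2 \<partial>PG N)" by simp
    next
      fix q :: real assume "0 < q"
      then show "\<exists>B. \<forall>u\<in>space \<mu>\<^sub>0. integrable (PG N) (\<lambda>\<omega>. norm (G u - GN N \<omega> u) powr q) \<and>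
          (\<integral>\<omega>. norm (G u - GN N \<omega> u) powr q \<partial>PG N) \<le> B"
        using pw unfolding space by blast
    qed (use M c L space exp_\<Phi> \<Phi>_meas in auto)
  qed

  \<comment> \<open>The emulated potential\<close>
  have R\<Phi>: "random_potential \<mu>\<^sub>0 (P\<Phi> N) ?\<Phi> (\<Phi>N N) (\<lambda>\<omega> u. \<bar>?\<Phi> u - \<Phi>N N \<omega> u\<bar>) M
      (exp (B\<Phi> + K / 2)) \<bar>tilt_const B\<Phi> K\<bar>" if N: "N \<ge> 1" for N
  proof -
    have P: "prob_space (P\<Phi> N)"
      using \<Phi>N_process[OF N] by (auto simp: gaussian_process_def)
    have proc[measurable]: "(\<lambda>p. \<Phi>N N (fst p) (snd p)) \<in> borel_measurable (P\<Phi> N \<Otimes>\<^sub>M \<mu>\<^sub>0)"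
      using \<Phi>N_version(1)[OF N] by (simp add: measurable_process_def case_prod_beta')
    have nrv: "normal_rv (P\<Phi> N) (\<lambda>\<omega>. \<Phi>N N \<omega> u) (?m\<Phi> N u) (?k N u u)" if "u \<in> U" for u
      by (rule gaussian_process_normal_rv[OF \<Phi>N_process[OF N] that])
    \<comment> \<open>The absolute value meets the locale's requirement \<open>0 \<le> C\<close>
      without a separate discussion of the sign of \<open>K\<close>.\<close>
    have le_abs: "tilt_const B\<Phi> K * x \<le> \<bar>tilt_const B\<Phi> K\<bar> * x" if "x \<ge> 0" for x
      using that by (intro mult_right_mono) auto
    show ?thesis
    proof (rule random_potential.intro[OF prior(1) P random_potential_axioms.intro])
      show "(\<lambda>(\<omega>, u). \<Phi>N N \<omega> u) \<in> borel_measurable (P\<Phi> N \<Otimes>\<^sub>M \<mu>\<^sub>0)"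
        unfolding case_prod_beta' by (rule proc)
      show "(\<lambda>(\<omega>, u). \<bar>?\<Phi> u - \<Phi>N N \<omega> u\<bar>) \<in> borel_measurable (P\<Phi> N \<Otimes>\<^sub>M \<mu>\<^sub>0)"
        unfolding case_prod_beta' by measurable
      fix u assume "u \<in> space \<mu>\<^sub>0"
      then have u: "u \<in> U" by (simp add: space)
      note args = P nrv[OF u] K[OF N u]
      have E: "has_bochner_integral (P\<Phi> N) (\<lambda>\<omega>. exp (- \<Phi>N N \<omega> u)) (exp (- ?m\<Phi> N u + ?k N u u / 2))"
        by (rule prob_space.normal_rv_exp[OF args(1,2)])
      then show "integrable (P\<Phi> N) (\<lambda>\<omega>. exp (- \<Phi>N N \<omega> u))" by (simp add: has_bochner_integral_iff)
      \<comment> \<open>The exact potential is nonnegative, so its distance to the predictive mean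
        bounds that mean from below by \<open>- B\<Phi>\<close>.\<close>
      have "- ?m\<Phi> N u + ?k N u u / 2 \<le> B\<Phi> + K / 2"
        using B\<Phi>[OF N u] K[OF N u] \<Phi>0[of G u] by linarith
      with E show "(\<integral>\<omega>. exp (- \<Phi>N N \<omega> u) \<partial>P\<Phi> N) \<le> exp (B\<Phi> + K / 2)"
        by (simp add: has_bochner_integral_iff)
      show "\<bar>exp (- ?\<Phi> u) - (\<integral>\<omega>. exp (- \<Phi>N N \<omega> u) \<partial>P\<Phi> N)\<bar>
          \<le> \<bar>tilt_const B\<Phi> K\<bar> * (\<integral>\<omega>. \<bar>?\<Phi> u - \<Phi>N N \<omega> u\<bar> \<partial>P\<Phi> N)"
        by (rule order_trans[OF prob_space.normal_rv_exp_diff_le[OF args \<Phi>0 B\<Phi>[OF N u]] le_abs])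
          (simp add: Bochner_Integration.integral_nonneg)
      show "(\<integral>\<omega>. (exp (- ?\<Phi> u / 2) - exp (- \<Phi>N N \<omega> u / 2))\<^sup>2 \<partial>P\<Phi> N)
          \<le> \<bar>tilt_const B\<Phi> K\<bar> * (\<integral>\<omega>. \<bar>?\<Phi> u - \<Phi>N N \<omega> u\<bar>\<^sup>2 \<partial>P\<Phi> N)"
        unfolding power2_abs
        by (rule order_trans[OF prob_space.normal_rv_exp_diff_sq_le[OF args \<Phi>0 B\<Phi>[OF N u]] le_abs])
          (simp add: Bochner_Integration.integral_nonneg)
    next
      fix q :: real assume q: "0 < q"
      show "\<exists>B. \<forall>u\<in>space \<mu>\<^sub>0. integrable (P\<Phi> N) (\<lambda>\<omega>. \<bar>?\<Phi> u - \<Phi>N N \<omega> u\<bar> powr q) \<and>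
          (\<integral>\<omega>. \<bar>?\<Phi> u - \<Phi>N N \<omega> u\<bar> powr q \<partial>P\<Phi> N) \<le> B"
        using prob_space.normal_rv_powr_moment[OF P nrv K[OF N] B\<Phi>[OF N] q] unfolding space by blast
    qed (use M c space exp_\<Phi> \<Phi>_meas in auto)
  qed

  \<comment> \<open>The exponents \<open>1 + \<delta>\<close> and \<open>2 + \<delta>\<close>
    satisfy the conditions \<open>q \<ge> 1\<close> and \<open>q \<ge> 2\<close>; the witnesses are
    the constants of the two Hellinger bounds, fixed before \<open>\<delta>\<close> and
    \<open>N\<close>.\<close>
  show ?thesis
    by (intro exI[of _ "exp M * (L + L\<^sup>2)"] exI[of _ "exp M * \<bar>tilt_const B\<Phi> K\<bar>"]
        exI[of _ "sqrt (exp M * (L + L\<^sup>2))"] exI[of _ "sqrt (exp M * \<bar>tilt_const B\<Phi> K\<bar>)"] allI impI conjI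
        random_potential.hellinger_marginal_le[OF RG] random_potential.hellinger_marginal_le[OF R\<Phi>]
        random_potential.hellinger_sample_le[OF RG] random_potential.hellinger_sample_le[OF R\<Phi>]) auto
qed

end
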